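(* Let $(\bar x,\bar y)\in S_{\rm Lag}(\bar p)$, where $\bar p=(\bar w,0,0)$. For each $\nu=1,\dots,N$, let $f_\nu:\mathbb R^n\times\mathbb R^d\to\mathbb R$ and $F_\nu:\mathbb R^n\times\mathbb R^d\to\mathbb R^{m_\nu}$ be twice differentiable with respect to $x$ in a neighborhood of $(\bar x,\bar w)$, and suppose that $f_\nu$, $F_\nu$, $\nabla_xf_\nu$ and $\mathcal J_xF_\nu$ are strictly differentiable with respect to $(x,w)$ in this neighborhood. Then $S_{\rm Lag}$ has a Lipschitz continuous single-valued localization at $\bar p$ for $(\bar x,\bar y)$ if and only if, for every choice of partitions $\beta_\nu=\beta_\nu^+\cup\beta_\nu^0\cup\beta_\nu^-$ ($\nu=1,\dots,N$; parts disjoint, possibly empty), with $\alpha_\nu^+=\alpha_\nu\cup\beta_\nu^+$, the following implication holds for $w_1=([w_1]_1,\dots,[w_1]_N)\in\mathbb R^n$ and vectors $[w_2]_{\alpha_\nu^+}\in\mathbb R^{|\alpha_\nu^+|}$, $[w_2]_{\beta_\nu^0}\in\mathbb R^{|\beta_\nu^0|}$: $$\left.\begin{array}{l}\mathbf G^Tw_1=\sum_{\nu=1}^N\big(\mathcal Jg_{\nu,\alpha_\nu^+}(\bar x)^T[w_2]_{\alpha_\nu^+}+\mathcal Jg_{\nu,\beta_\nu^0}(\bar x)^T[w_2]_{\beta_\nu^0}\big)\\ \mathcal J_{x^\nu}g_{\nu,\alpha_\nu^+}(\bar x)[w_1]_\nu=0,\ \mathcal J_{x^\nu}g_{\nu,\beta_\nu^0}(\bar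 x)[w_1]_\nu\le0,\ [w_2]_{\beta_\nu^0}\ge0,\ \nu=1,\dots,N\end{array}\right\}\Longrightarrow w_1=0,\ [w_2]_{\alpha_\nu^+\cup\beta_\nu^0}=0\ (\nu=1,\dots,N).$$
   Context: **Setting.** There are $N$ players, $n=n_1+\dots+n_N$, $x=(x^1,\dots,x^N)\in\mathbb R^n$ with $x^\nu\in\mathbb R^{n_\nu}$, and $x^{-\nu}$ denotes the other blocks. For each $\nu$, $K_\nu=\{0_{q_\nu}\}\times\mathbb R_-^{m_\nu-q_\nu}\subset\mathbb R^{m_\nu}$, so its polar is $K_\nu^\circ=\mathbb R^{q_\nu}\times\mathbb R_+^{m_\nu-q_\nu}$; $m=m_1+\dots+m_N$. Given $p=(w,v,u)\in\mathbb R^d\times\mathbb R^n\times\mathbb R^m$, player $\nu$ minimizes $f_\nu(x^\nu,x^{-\nu};w)-\langle v^\nu,x^\nu\rangle$ over $x^\nu\in\mathbb R^{n_\nu}$ subject to $F_\nu(x^\nu,x^{-\nu};w)-u^\nu\in K_\nu$. The set of Lagrangian generalized Nash equilibria is $$S_{\rm Lag}(p)=\{(x,y)\in\mathbb R^n\times\mathbb R^m:\ \nabla_{x^\nu}f_\nu(x;w)+\mathcal J_{x^\nu}F_\nu(x;w)^Ty^\nu-v^\nu=0,\ 0\in-F_\nu(x;w)+u^\nu+N_{K_\nu^\circ}(y^\nu),\ \nu=1,\dots,N\},$$ with $N_C$ the normal cone of convex analysis and $\mathcal J$ the Jacobian. **Notation.** Fix $\bar w\in\mathbb R^d$; $\theta_\nu=f_\nu(\cdot;\bar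 w)$, $g_\nu=F_\nu(\cdot;\bar w)$, $l_\nu(x,y^\nu)=\theta_\nu(x)+\langle y^\nu,g_\nu(x)\rangle$. $\mathbf G$ is the $n\times n$ matrix with $(\nu,\mu)$ block $\nabla^2_{x^\nu x^\mu}l_\nu(\bar x,\bar y^\nu)$ (derivative in $x^\mu$ of $\nabla_{x^\nu}l_\nu$). Index sets: $\alpha_\nu=\{1,\dots,q_\nu\}\cup\{i\in\{q_\nu+1,\dots,m_\nu\}:[g_\nu]_i(\bar x)=0<\bar y^\nu_i\}$, $\beta_\nu=\{i\in\{q_\nu+1,\dots,m_\nu\}:[g_\nu]_i(\bar x)=0=\bar y_i^\nu\}$. For an index set $I$, $g_{\nu,I}$ is the subvector of $g_\nu$ with indices in $I$; $\mathcal Jg_{\nu,I}$ is its Jacobian in all of $x$ and $\mathcal J_{x^\nu}g_{\nu,I}$ its Jacobian in $x^\nu$. **Localization.** A set-valued $S$ has a Lipschitz continuous single-valued localization at $\bar a$ for $\bar b\in S(\bar a)$ if there are open neighborhoods $U$ of $\bar a$, $V$ of $\bar b$ and a single-valued Lipschitz continuous $s:U\to V$ with ${\rm gph}\,s={\rm gph}\,S\cap(U\times V)$. *)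

theory Defs
  imports "HOL-Analysis.Analysis"
begin

section \<open>Notions of variational analysis\<close>

text \<open>
  Both cones are taken relative to an ambient linear subspace \<open>L\<close>, so that polars and normals of a
  set in one block of \<open>\<real>\<^sup>m\<close> are formed inside that block. As usual, the normal cone at a point
  outside the set is empty.
\<close>

definition polar_cone_in :: "'a::real_inner set \<Rightarrow> 'a set \<Rightarrow> 'a set" where
  "polar_cone_in L C = {y \<in> L. \<forall>z\<in>C. y \<bullet> z \<le> 0}"

definition normal_cone_in :: "'a::real_inner set \<Rightarrow> 'a set \<Rightarrow> 'a \<Rightarrow> 'a set" where
  "normal_cone_in L C y = {z \<in> L. y \<in> C \<and> (\<forall>c\<in>C. z \<bullet> (c - y) \<le> 0)}"

definition strictly_differentiable_at ::
  "('a::real_normed_vector \<Rightarrow> 'b::real_normed_vector) \<Rightarrow> 'a \<Rightarrow> bool" where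
  "strictly_differentiable_at h a \<longleftrightarrow>
     (\<exists>L. bounded_linear L \<and>
       (\<forall>e>0. \<exists>d>0. \<forall>x\<in>ball a d. \<forall>z\<in>ball a d.
          norm (h x - h z - L (x - z)) \<le> e * norm (x - z)))"

definition twice_differentiable_at ::
  "('a::real_normed_vector \<Rightarrow> 'b::real_normed_vector) \<Rightarrow> 'a \<Rightarrow> bool" where
  "twice_differentiable_at h a \<longleftrightarrow>
     (\<exists>D :: 'a \<Rightarrow> ('a \<Rightarrow>\<^sub>L 'b).
        (\<forall>\<^sub>F x in nhds a. (h has_derivative blinfun_apply (D x)) (at x)) \<and>
        D differentiable (at a))"

definition gradient :: "('a::real_inner \<Rightarrow> real) \<Rightarrow> 'a \<Rightarrow> 'a" where
  "gradient h x = (THE D. GDERIV h x :> D)"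

definition graph_of :: "('a \<Rightarrow> 'b set) \<Rightarrow> ('a \<times> 'b) set" where
  "graph_of S = {(a, b). b \<in> S a}"

definition has_lipschitz_localization ::
  "('a::metric_space \<Rightarrow> 'b::metric_space set) \<Rightarrow> 'a \<Rightarrow> 'b \<Rightarrow> bool" where
  "has_lipschitz_localization S a b \<longleftrightarrow>
     (\<exists>U V s. open U \<and> a \<in> U \<and> open V \<and> b \<in> V \<and> s ` U \<subseteq> V \<and>
        (\<exists>C. C-lipschitz_on U s) \<and>
        {(p, s p) | p. p \<in> U} = graph_of S \<inter> (U \<times> V))"


section \<open>The game\<close>

text \<open>
  Players are the elements of a finite type \<open>'p\<close>. The coordinates of \<open>x\<close> and of \<open>y\<close> are indexed by
  finite types \<open>'n\<close> and \<open>'m\<close>, and the splitting into blocks is given by maps \<open>own :: 'n \<Rightarrow> 'p\<close> and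
  \<open>con :: 'm \<Rightarrow> 'p\<close> that tell to which player a coordinate belongs; thus \<open>n\<^sub>\<nu>\<close> and \<open>m\<^sub>\<nu>\<close> are the
  cardinalities of the fibres over \<open>\<nu>\<close>. The space \<open>\<real>\<close> to the power \<open>n\<^sub>\<nu>\<close> is represented by the
  subspace \<open>block_space own \<nu>\<close> of the vectors that vanish outside the block of \<open>\<nu>\<close>, and \<open>x\<^sup>\<nu>\<close> by
  \<open>block own \<nu> x\<close>.

  The set \<open>E\<close> collects the indices of the equality constraints (the first \<open>q\<^sub>\<nu>\<close> indices of each
  player \<open>\<nu>\<close>); all other indices belong to inequality constraints. The functions \<open>F\<^sub>\<nu>\<close> are stacked
  into one function \<open>F\<close>, of which \<open>F\<^sub>\<nu>\<close> is the \<open>\<nu>\<close>-th block.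
\<close>

definition block_space :: "('i::finite \<Rightarrow> 'p) \<Rightarrow> 'p \<Rightarrow> (real^'i) set" where
  "block_space own \<nu> = {z. \<forall>i. own i \<noteq> \<nu> \<longrightarrow> z $ i = 0}"

definition block :: "('i::finite \<Rightarrow> 'p) \<Rightarrow> 'p \<Rightarrow> real^'i \<Rightarrow> real^'i" where
  "block own \<nu> z = (\<chi> i. if own i = \<nu> then z $ i else 0)"

definition player_F ::
  "('m::finite \<Rightarrow> 'p) \<Rightarrow> ((real^'n) \<times> (real^'d) \<Rightarrow> real^'m) \<Rightarrow> 'p \<Rightarrow> (real^'n) \<times> (real^'d) \<Rightarrow> real^'m" where
  "player_F con F \<nu> z = block con \<nu> (F z)"

definition K_cone :: "('m::finite \<Rightarrow> 'p) \<Rightarrow> 'm set \<Rightarrow> 'p \<Rightarrow> (real^'m) set" where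
  "K_cone con E \<nu> =
     {z \<in> block_space con \<nu>. \<forall>i. con i = \<nu> \<longrightarrow> (if i \<in> E then z $ i = 0 else z $ i \<le> 0)}"

definition K_polar :: "('m::finite \<Rightarrow> 'p) \<Rightarrow> 'm set \<Rightarrow> 'p \<Rightarrow> (real^'m) set" where
  "K_polar con E \<nu> = polar_cone_in (block_space con \<nu>) (K_cone con E \<nu>)"

text \<open>
  Where a derivative does not exist, \<open>gradient\<close> and \<open>jacobian\<close> have unspecified values. This is
  harmless: the existence of a localization of \<open>S_Lag\<close> for \<open>(x, y)\<close> at a parameter \<open>(w, v, u)\<close>
  depends only on \<open>f\<close> and \<open>F\<close> near \<open>(x, w)\<close>.
\<close>

definition S_Lag ::
  "('n::finite \<Rightarrow> 'p) \<Rightarrow> ('m::finite \<Rightarrow> 'p) \<Rightarrow> 'm set \<Rightarrow>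
   ('p \<Rightarrow> (real^'n) \<times> (real^'d::finite) \<Rightarrow> real) \<Rightarrow> ((real^'n) \<times> (real^'d) \<Rightarrow> real^'m) \<Rightarrow>
   (real^'d) \<times> (real^'n) \<times> (real^'m) \<Rightarrow> ((real^'n) \<times> (real^'m)) set" where
  "S_Lag own con E f F = (\<lambda>(w, v, u). {(x, y). \<forall>\<nu>.
      block own \<nu> (gradient (\<lambda>z. f \<nu> (z, w)) x)
        + block own \<nu> (transpose (jacobian (\<lambda>z. player_F con F \<nu> (z, w)) (at x)) *v block con \<nu> y)
        - block own \<nu> v = 0 \<and>
      0 \<in> (\<lambda>z. - player_F con F \<nu> (x, w) + block con \<nu> u + z) `
            normal_cone_in (block_space con \<nu>) (K_polar con E \<nu>) (block con \<nu> y)})"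

definition lagrangian ::
  "('m::finite \<Rightarrow> 'p) \<Rightarrow> ('p \<Rightarrow> (real^'n) \<times> (real^'d) \<Rightarrow> real) \<Rightarrow>
   ((real^'n) \<times> (real^'d) \<Rightarrow> real^'m) \<Rightarrow> real^'d \<Rightarrow> 'p \<Rightarrow> real^'n \<Rightarrow> real^'m \<Rightarrow> real" where
  "lagrangian con f F w \<nu> x y = f \<nu> (x, w) + block con \<nu> y \<bullet> player_F con F \<nu> (x, w)"

text \<open>
  Row \<open>i\<close> of the following matrix is row \<open>i\<close> of the Hessian of the Lagrangian of the player who
  controls \<open>x\<^sub>i\<close>, so that its \<open>(\<nu>, \<mu>)\<close> block contains the derivatives in \<open>x\<^sup>\<mu>\<close> of the partial gradient
  in \<open>x\<^sup>\<nu>\<close> of the Lagrangian of \<open>\<nu>\<close>.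
\<close>

definition G_matrix ::
  "('n::finite \<Rightarrow> 'p) \<Rightarrow> ('m::finite \<Rightarrow> 'p) \<Rightarrow> ('p \<Rightarrow> (real^'n) \<times> (real^'d) \<Rightarrow> real) \<Rightarrow>
   ((real^'n) \<times> (real^'d) \<Rightarrow> real^'m) \<Rightarrow> real^'d \<Rightarrow> real^'n \<Rightarrow> real^'m \<Rightarrow> real^'n^'n" where
  "G_matrix own con f F w x y =
     (\<chi> i j. jacobian (\<lambda>z. gradient (\<lambda>x'. lagrangian con f F w (own i) x' y) z) (at x) $ i $ j)"

definition \<alpha>_set ::
  "('m::finite \<Rightarrow> 'p) \<Rightarrow> 'm set \<Rightarrow> (real^'n \<Rightarrow> real^'m) \<Rightarrow> real^'n \<Rightarrow> real^'m \<Rightarrow> 'p \<Rightarrow> 'm set" where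
  "\<alpha>_set con E g x y \<nu> =
     {i. con i = \<nu> \<and> i \<in> E} \<union> {i. con i = \<nu> \<and> i \<notin> E \<and> g x $ i = 0 \<and> 0 < y $ i}"

definition \<beta>_set ::
  "('m::finite \<Rightarrow> 'p) \<Rightarrow> 'm set \<Rightarrow> (real^'n \<Rightarrow> real^'m) \<Rightarrow> real^'n \<Rightarrow> real^'m \<Rightarrow> 'p \<Rightarrow> 'm set" where
  "\<beta>_set con E g x y \<nu> = {i. con i = \<nu> \<and> i \<notin> E \<and> g x $ i = 0 \<and> y $ i = 0}"

end

theory Submission
  imports Defs
begin

text \<open>
  Put \<open>z = y + F(x, w) - u\<close>. Then \<open>(x, y)\<close> is a solution for the parameter \<open>(w, v, u)\<close> iff
  \<open>y = P z\<close>, for the projection \<open>P\<close> onto the polar of the product of the cones \<open>K\<^sub>\<nu>\<close>, and the normal map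
  \<open>(x, z, w) \<mapsto> (w, L(x, P z, w), F(x, w) - (z - P z))\<close> takes the value \<open>(w, v, u)\<close>, where \<open>L\<close>
  collects the partial gradients of the Lagrangians. Since \<open>P\<close> acts coordinatewise, differences of the
  normal map are, up to a small error, given by matrices that depend affinely on each of the
  difference quotients \<open>D\<^sub>k \<in> [0, 1]\<close> of the coordinates of \<open>P\<close>.

  If the implication holds, the determinants of these matrices at the vertices of the cube of all
  \<open>D\<close> have one sign, since a change of sign along an edge would give a matrix with a nontrivial left
  kernel there, contradicting the implication for a \<open>\<beta>\<^sup>0\<close> with one element. Hence all the matrices
  are regular, the normal map is injective with Lipschitz inverse near the reference point, and by
  invariance of domain its image is open, which gives the localization. Conversely, a vector
  violating the implication is a parameter direction along which a Lipschitz selection of solutions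
  cannot exist.
\<close>

section \<open>Strict derivatives\<close>

text \<open>No symmetry or definiteness is available: \<open>G\<close> need not be symmetric, and
  \<open>B\<close>, which contains derivatives in each player's own variables only, is in general
  not the transpose of \<open>C\<close>. Regularity therefore has to come from signs of
  determinants. The projection has kinks at the weakly active indices, so secants take the place of
  its derivative. A secant is exact, but it depends on the pair of points in an uncontrolled way.
  Hence all admissible \<open>D\<close> are treated at once, and compactness turns their regularity
  into one constant. In both directions of the proof the two points that are compared lie near the
  reference point, but in general neither of them is that point. Strict derivatives linearize all
  such pairs with the same matrices \<open>G\<close>, \<open>B\<close>, \<open>C\<close> and an
  error proportional to the distance of the pair; an ordinary derivative would bound the error only
  by the distances to the reference point.\<close>

definition strict_derivative ::
  "('a::real_normed_vector \<Rightarrow> 'b::real_normed_vector) \<Rightarrow> ('a \<Rightarrow> 'b) \<Rightarrow> 'a \<Rightarrow> bool" where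
  "strict_derivative h L a \<longleftrightarrow> bounded_linear L \<and>
     (\<forall>e>0. \<exists>d>0. \<forall>x\<in>ball a d. \<forall>z\<in>ball a d.
        norm (h x - h z - L (x - z)) \<le> e * norm (x - z))"

lemma strictly_differentiable_at_iff:
  "strictly_differentiable_at h a \<longleftrightarrow> (\<exists>L. strict_derivative h L a)"
  unfolding strictly_differentiable_at_def strict_derivative_def ..

lemma strict_derivative_bounded_linear: "strict_derivative h L a \<Longrightarrow> bounded_linear L"
  unfolding strict_derivative_def by blast

lemma strict_derivativeD:
  assumes "strict_derivative h L a" "e > 0"
  shows "\<exists>d>0. \<forall>x\<in>ball a d. \<forall>z\<in>ball a d. norm (h x - h z - L (x - z)) \<le> e * norm (x - z)"
  using assms unfolding strict_derivative_def by blast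

lemma strict_derivative_imp_has_derivative:
  assumes "strict_derivative h L a"
  shows "(h has_derivative L) (at a)"
  unfolding has_derivative_at_alt
proof (intro conjI allI impI)
  show "bounded_linear L" by (rule strict_derivative_bounded_linear[OF assms])
  fix e :: real assume "0 < e"
  then obtain d where "d > 0"
    and d: "\<And>x z. x \<in> ball a d \<Longrightarrow> z \<in> ball a d \<Longrightarrow> norm (h x - h z - L (x - z)) \<le> e * norm (x - z)"
    using strict_derivativeD[OF assms] by blast
  show "\<exists>d>0. \<forall>y. norm (y - a) < d \<longrightarrow> norm (h y - h a - L (y - a)) \<le> e * norm (y - a)"
    using \<open>d > 0\<close> d by (intro exI[of _ d]) (auto simp: dist_norm norm_minus_commute)
qed

lemma strict_derivative_lipschitz:
  assumes "strict_derivative h L a"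
  obtains d K where "d > 0" "K > 0"
    "\<And>x z. x \<in> ball a d \<Longrightarrow> z \<in> ball a d \<Longrightarrow> norm (h x - h z) \<le> K * norm (x - z)"
proof -
  obtain k where k: "k > 0" "\<And>x. norm (L x) \<le> norm x * k"
    using bounded_linear.pos_bounded[OF strict_derivative_bounded_linear[OF assms]] by blast
  obtain d where "d > 0" and d: "\<And>x z. x \<in> ball a d \<Longrightarrow> z \<in> ball a d \<Longrightarrow>
      norm (h x - h z - L (x - z)) \<le> 1 * norm (x - z)"
    using strict_derivativeD[OF assms zero_less_one] by blast
  have "norm (h x - h z) \<le> (k + 1) * norm (x - z)" if "x \<in> ball a d" "z \<in> ball a d" for x z
    using d[OF that] k(2)[of "x - z"] norm_triangle_sub[of "h x - h z" "L (x - z)"]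
    by (simp add: algebra_simps)
  with \<open>d > 0\<close> \<open>k > 0\<close> that[of d "k + 1"] show ?thesis by simp
qed

lemma strict_derivative_compose:
  assumes g: "strict_derivative g M (h a)" and h: "strict_derivative h L a"
  shows "strict_derivative (\<lambda>x. g (h x)) (\<lambda>x. M (L x)) a"
  unfolding strict_derivative_def
proof (intro conjI allI impI)
  note M = strict_derivative_bounded_linear[OF g] and L = strict_derivative_bounded_linear[OF h]
  show "bounded_linear (\<lambda>x. M (L x))" by (rule bounded_linear_compose[OF M L])
  fix e :: real assume "0 < e"
  obtain k where k: "k > 0" "\<And>x. norm (M x) \<le> norm x * k"
    using bounded_linear.pos_bounded[OF M] by blast
  obtain d1 K where d1: "d1 > 0" "K > 0"
    "\<And>x z. x \<in> ball a d1 \<Longrightarrow> z \<in> ball a d1 \<Longrightarrow> norm (h x - h z) \<le> K * norm (x - z)"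
    using strict_derivative_lipschitz[OF h] by blast
  \<comment> \<open>Each error gets half of \<open>e\<close>: \<open>h\<close> stretches distances
    by at most \<open>K\<close> before the error of \<open>g\<close> enters, and \<open>M\<close>
    magnifies the error of \<open>h\<close> by at most \<open>k\<close>.\<close>
  have pos: "e / (2 * K) > 0" "e / (2 * k) > 0" using \<open>0 < e\<close> d1 k by auto
  obtain d2 where d2: "d2 > 0" "\<And>x z. x \<in> ball (h a) d2 \<Longrightarrow> z \<in> ball (h a) d2 \<Longrightarrow>
       norm (g x - g z - M (x - z)) \<le> e / (2 * K) * norm (x - z)"
    using strict_derivativeD[OF g pos(1)] by blast
  obtain d3 where d3: "d3 > 0" "\<And>x z. x \<in> ball a d3 \<Longrightarrow> z \<in> ball a d3 \<Longrightarrow>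
       norm (h x - h z - L (x - z)) \<le> e / (2 * k) * norm (x - z)"
    using strict_derivativeD[OF h pos(2)] by blast
  \<comment> \<open>The radius \<open>d2 / K\<close> keeps \<open>h x\<close> inside the ball around
    \<open>h a\<close> on which \<open>g\<close> is controlled.\<close>
  define d where "d = min d1 (min d3 (d2 / K))"
  have "d > 0" using d1 d2 d3 by (simp add: d_def)
  have in_ball: "h x \<in> ball (h a) d2" if "x \<in> ball a d" for x
  proof -
    have "norm (h a - h x) \<le> K * norm (a - x)" using that d1 by (intro d1) (auto simp: d_def)
    also have "\<dots> < K * (d2 / K)" using that d1 by (intro mult_strict_left_mono) (auto simp: d_def dist_norm)
    finally show ?thesis using d1 by (simp add: dist_norm)
  qed
  have "norm (g (h x) - g (h z) - M (L (x - z))) \<le> e * norm (x - z)"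
    if "x \<in> ball a d" "z \<in> ball a d" for x z
  proof -
    have "g (h x) - g (h z) - M (L (x - z))
       = (g (h x) - g (h z) - M (h x - h z)) + M (h x - h z - L (x - z))"
      by (simp add: linear_diff bounded_linear.linear[OF M])
    also have "norm \<dots> \<le> e / (2 * K) * norm (h x - h z) + norm (h x - h z - L (x - z)) * k"
      by (intro norm_triangle_mono d2 in_ball that k)
    also have "\<dots> \<le> e / (2 * K) * (K * norm (x - z)) + e / (2 * k) * norm (x - z) * k"
      using that d1 \<open>0 < e\<close> k by (intro add_mono mult_left_mono mult_right_mono d1 d3) (auto simp: d_def)
    also have "\<dots> = e * norm (x - z)" using k d1 by (simp add: field_simps)
    finally show ?thesis .
  qed
  with \<open>d > 0\<close> show "\<exists>d>0. \<forall>x\<in>ball a d. \<forall>z\<in>ball a d.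
      norm (g (h x) - g (h z) - M (L (x - z))) \<le> e * norm (x - z)" by blast
qed

lemma strict_derivative_linear: "bounded_linear T \<Longrightarrow> strict_derivative T T a"
  unfolding strict_derivative_def
  by (auto intro!: exI[of _ 1] simp: linear_diff bounded_linear.linear)

lemma strict_derivative_compose_linear:
  assumes "bounded_linear T" "strict_derivative h L (T a)"
  shows "strict_derivative (\<lambda>x. h (T x)) (\<lambda>x. L (T x)) a"
  by (rule strict_derivative_compose[OF assms(2) strict_derivative_linear[OF assms(1)]])

lemma strict_derivative_linear_compose:
  assumes "bounded_linear T" "strict_derivative h L a"
  shows "strict_derivative (\<lambda>x. T (h x)) (\<lambda>x. T (L x)) a"
  by (rule strict_derivative_compose[OF strict_derivative_linear[OF assms(1)] assms(2)])

lemma strict_derivative_add: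
  assumes "strict_derivative g M a" "strict_derivative h L a"
  shows "strict_derivative (\<lambda>x. g x + h x) (\<lambda>x. M x + L x) a"
  unfolding strict_derivative_def
proof (intro conjI allI impI)
  show "bounded_linear (\<lambda>x. M x + L x)"
    using assms by (intro bounded_linear_add strict_derivative_bounded_linear)
  fix e :: real assume "0 < e"
  then have pos: "e / 2 > 0" by simp
  obtain d where d: "d > 0" "\<And>x z. x \<in> ball a d \<Longrightarrow> z \<in> ball a d \<Longrightarrow>
       norm (g x - g z - M (x - z)) \<le> e / 2 * norm (x - z)"
    using strict_derivativeD[OF assms(1) pos] by blast
  obtain d' where d': "d' > 0" "\<And>x z. x \<in> ball a d' \<Longrightarrow> z \<in> ball a d' \<Longrightarrow>
       norm (h x - h z - L (x - z)) \<le> e / 2 * norm (x - z)"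
    using strict_derivativeD[OF assms(2) pos] by blast
  have "norm (g x + h x - (g z + h z) - (M (x - z) + L (x - z))) \<le> e * norm (x - z)"
    if "x \<in> ball a (min d d')" "z \<in> ball a (min d d')" for x z
  proof -
    have "g x + h x - (g z + h z) - (M (x - z) + L (x - z))
      = (g x - g z - M (x - z)) + (h x - h z - L (x - z))" by simp
    also have "norm \<dots> \<le> e / 2 * norm (x - z) + e / 2 * norm (x - z)"
      using that by (intro norm_triangle_mono d d') auto
    finally show ?thesis by simp
  qed
  with d(1) d'(1) show "\<exists>d>0. \<forall>x\<in>ball a d. \<forall>z\<in>ball a d.
     norm (g x + h x - (g z + h z) - (M (x - z) + L (x - z))) \<le> e * norm (x - z)"
    by (intro exI[of _ "min d d'"]) auto
qed

lemma strict_derivative_sum: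
  assumes "finite I" "\<And>i. i \<in> I \<Longrightarrow> strict_derivative (h i) (L i) a"
  shows "strict_derivative (\<lambda>x. \<Sum>i\<in>I. h i x) (\<lambda>x. \<Sum>i\<in>I. L i x) a"
  using assms
proof (induction I rule: finite_induct)
  case empty
  then show ?case using strict_derivative_linear[OF bounded_linear_zero] by simp
next
  case (insert i I)
  then show ?case by (simp add: strict_derivative_add)
qed

text \<open>A vector is the sum of its coordinates times unit vectors, so linearity and the error
  bound are both inherited from the coordinates. This suits maps whose rows come from different
  players.\<close>

lemma strict_derivative_componentwise:
  fixes h :: "'a::real_normed_vector \<Rightarrow> real^'n"
  assumes "\<And>i. strict_derivative (\<lambda>x. h x $ i) (\<lambda>x. L x $ i) a"
  shows "strict_derivative h L a"
proof -
  have axis: "bounded_linear (axis i :: real \<Rightarrow> real^'n)" for i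
    by (intro linear_linear[THEN iffD2] linearI) (auto simp: axis_def vec_eq_iff)
  have "strict_derivative (\<lambda>x. \<Sum>i\<in>UNIV. axis i (h x $ i)) (\<lambda>x. \<Sum>i\<in>UNIV. axis i (L x $ i)) a"
    by (intro strict_derivative_sum strict_derivative_linear_compose[OF axis] assms) simp
  moreover have "(\<Sum>i\<in>UNIV. axis i (v $ i)) = v" for v :: "real^'n"
    by (simp add: vec_eq_iff axis_def)
  ultimately show ?thesis by simp
qed

text \<open>Product rule. It serves the term of the Lagrangian gradient in which the transposed
  constraint Jacobian, a function of \<open>(x, w)\<close>, multiplies the independent variable
  \<open>y\<close>.\<close>

lemma strict_derivative_bilinear:
  assumes P: "bounded_bilinear bop"
    and g: "strict_derivative g M a" and h: "strict_derivative h L a"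
  shows "strict_derivative (\<lambda>x. bop (g x) (h x)) (\<lambda>x. bop (g a) (L x) + bop (M x) (h a)) a"
  unfolding strict_derivative_def
proof (intro conjI allI impI)
  interpret P: bounded_bilinear bop by (rule P)
  note M = strict_derivative_bounded_linear[OF g] and L = strict_derivative_bounded_linear[OF h]
  show "bounded_linear (\<lambda>x. bop (g a) (L x) + bop (M x) (h a))"
    by (intro bounded_linear_add bounded_linear_compose[OF P.bounded_linear_right L]
        bounded_linear_compose[OF P.bounded_linear_left M])
  fix e :: real assume "0 < e"
  obtain p where p: "p > 0" "\<And>x y. norm (bop x y) \<le> norm x * norm y * p"
    using P.pos_bounded by blast
  obtain k where k: "k > 0" "\<And>x. norm (M x) \<le> norm x * k"
    using bounded_linear.pos_bounded[OF M] by blast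
  obtain l where l: "l > 0" "\<And>x. norm (L x) \<le> norm x * l"
    using bounded_linear.pos_bounded[OF L] by blast
  \<comment> \<open>The final estimate is \<delta> times the distance times the sum of
    \<open>c\<close> and \<open>p\<close>; the summand 1 in \<open>c\<close> ensures
    \<open>p\<close> \<le> \<open>c\<close>, whence the factor 2 in the choice of \<delta>.\<close>
  define c where "c = (norm (g a) + norm (h a) + 1 + k + l) * p"
  have "norm (g a) + norm (h a) + 1 + k + l > 0"
    using k l norm_ge_zero[of "g a"] norm_ge_zero[of "h a"] by linarith
  then have "c > 0" using p by (simp add: c_def)
  define \<delta> where "\<delta> = min 1 (e / (2 * c))"
  have "\<delta> > 0" "\<delta> \<le> 1" "2 * c * \<delta> \<le> e"
    using \<open>0 < e\<close> \<open>c > 0\<close> by (auto simp: \<delta>_def min_def field_simps)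
  obtain d1 where d1: "d1 > 0" "\<And>x z. x \<in> ball a d1 \<Longrightarrow> z \<in> ball a d1 \<Longrightarrow>
       norm (g x - g z - M (x - z)) \<le> \<delta> * norm (x - z)"
    using strict_derivativeD[OF g \<open>\<delta> > 0\<close>] by blast
  obtain d2 where d2: "d2 > 0" "\<And>x z. x \<in> ball a d2 \<Longrightarrow> z \<in> ball a d2 \<Longrightarrow>
       norm (h x - h z - L (x - z)) \<le> \<delta> * norm (x - z)"
    using strict_derivativeD[OF h \<open>\<delta> > 0\<close>] by blast
  have cont: "isCont g a" "isCont h a"
    using strict_derivative_imp_has_derivative has_derivative_continuous g h by blast+
  then obtain d3 where d3: "d3 > 0" "\<And>x. dist x a < d3 \<Longrightarrow> dist (g x) (g a) < \<delta>"
    using \<open>\<delta> > 0\<close> unfolding continuous_at_eps_delta by blast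
  obtain d4 where d4: "d4 > 0" "\<And>x. dist x a < d4 \<Longrightarrow> dist (h x) (h a) < \<delta>"
    using cont(2) \<open>\<delta> > 0\<close> unfolding continuous_at_eps_delta by blast
  define d where "d = min (min d1 d2) (min d3 d4)"
  have "d > 0" using d1 d2 d3 d4 by (simp add: d_def)
  have "norm (bop (g x) (h x) - bop (g z) (h z) - (bop (g a) (L (x - z)) + bop (M (x - z)) (h a)))
      \<le> e * norm (x - z)" if "x \<in> ball a d" "z \<in> ball a d" for x z
  proof -
    let ?n = "norm (x - z)"
    have gx: "norm (g x - g a) \<le> \<delta>" and hz: "norm (h z - h a) \<le> \<delta>"
      using d3(2)[of x] d4(2)[of z] that by (auto simp: d_def dist_norm norm_minus_commute)
    have gx': "norm (g x) \<le> norm (g a) + 1" and hz': "norm (h z) \<le> norm (h a) + 1"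
      using gx hz \<open>\<delta> \<le> 1\<close> norm_triangle_sub[of "g x" "g a"] norm_triangle_sub[of "h z" "h a"] by linarith+
    \<comment> \<open>Telescoping into four products, each with one factor that is small by strict
      differentiability or by continuity at \<open>a\<close>.\<close>
    have "bop (g x) (h x) - bop (g z) (h z) - (bop (g a) (L (x - z)) + bop (M (x - z)) (h a))
      = (bop (g x) (h x - h z - L (x - z)) + bop (g x - g a) (L (x - z)))
        + (bop (g x - g z - M (x - z)) (h z) + bop (M (x - z)) (h z - h a))"
      by (simp add: P.diff_left P.diff_right)
    also have "norm \<dots> \<le> (norm (g x) * norm (h x - h z - L (x - z)) * p + norm (g x - g a) * norm (L (x - z)) * p)
        + (norm (g x - g z - M (x - z)) * norm (h z) * p + norm (M (x - z)) * norm (h z - h a) * p)"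
      by (intro norm_triangle_mono p)
    also have "\<dots> \<le> ((norm (g a) + 1) * (\<delta> * ?n) * p + \<delta> * (?n * l) * p)
        + (\<delta> * ?n * (norm (h a) + 1) * p + ?n * k * \<delta> * p)"
      using that p k l \<open>\<delta> > 0\<close>
      by (intro add_mono mult_mono mult_right_mono d1 d2 gx hz gx' hz' k l) (auto simp: d_def)
    also have "\<dots> = \<delta> * ?n * ((norm (g a) + norm (h a) + 1 + k + l) * p + p)" by (simp add: algebra_simps)
    also have "\<dots> \<le> \<delta> * ?n * (c + c)"
      using \<open>\<delta> > 0\<close> p k l mult_right_mono[of 1 "norm (g a) + norm (h a) + 1 + k + l" p]
      unfolding c_def by (intro mult_left_mono add_mono) (auto)
    also have "\<dots> = (2 * c * \<delta>) * ?n" by simp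
    also have "\<dots> \<le> e * ?n" by (intro mult_right_mono \<open>2 * c * \<delta> \<le> e\<close>) simp
    finally show ?thesis .
  qed
  with \<open>d > 0\<close> show "\<exists>d>0. \<forall>x\<in>ball a d. \<forall>z\<in>ball a d.
      norm (bop (g x) (h x) - bop (g z) (h z) - (bop (g a) (L (x - z)) + bop (M (x - z)) (h a)))
      \<le> e * norm (x - z)" by blast
qed

section \<open>Multi-affine determinants\<close>

lemma affine_same_sign:
  fixes a b :: real
  assumes "\<And>t. 0 \<le> t \<Longrightarrow> t \<le> 1 \<Longrightarrow> t * a + (1 - t) * b \<noteq> 0"
  shows "0 < a * b"
proof (rule ccontr)
  assume "\<not> 0 < a * b"
  moreover have "a \<noteq> 0" "b \<noteq> 0" using assms[of 1] assms[of 0] by auto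
  ultimately have "(0 < b \<and> a < 0) \<or> (b < 0 \<and> 0 < a)"
    by (auto simp: zero_less_mult_iff)
  \<comment> \<open>For opposite signs this is the root of the affine function with value
    \<open>b\<close> at 0 and \<open>a\<close> at 1.\<close>
  then have "0 \<le> b / (b - a)" "b / (b - a) \<le> 1" "b - a \<noteq> 0"
    by (auto simp: divide_simps)
  moreover have "b / (b - a) * a + (1 - b / (b - a)) * b = 0"
    using \<open>b - a \<noteq> 0\<close> by (simp add: field_simps)
  ultimately show False using assms by blast
qed

text \<open>On each edge of the cube an affine function without zeros keeps its sign, so the values at
  the vertices have one sign, and so have their convex combinations.\<close>

lemma multiaffine_nonzero:
  fixes h :: "('m \<Rightarrow> real) \<Rightarrow> real"
  assumes S: "finite S"
    and affine: "\<And>D k t. k \<in> S \<Longrightarrow> h (D(k := t)) = t * h (D(k := 1)) + (1 - t) * h (D(k := 0))"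
    and edge: "\<And>D k. (\<forall>j\<in>S - {k}. D j \<in> {0, 1}) \<Longrightarrow> (k \<in> S \<longrightarrow> D k \<in> {0..1}) \<Longrightarrow>
      (\<forall>j. j \<notin> S \<longrightarrow> D j = D0 j) \<Longrightarrow> h D \<noteq> 0"
    and D: "\<forall>j\<in>S. D j \<in> {0..1}" "\<forall>j. j \<notin> S \<longrightarrow> D j = D0 j"
  shows "h D \<noteq> 0"
proof -
  \<comment> \<open>The vertex with all coordinates of \<open>S\<close> equal to 0; all other values
    of \<open>h\<close> are compared in sign with its value there.\<close>
  define e where "e = (\<lambda>j. if j \<in> S then 0 else D0 j)"
  have vertex: "0 < h e * h (\<lambda>j. if j \<in> T then 1 else e j)" if "finite T" "T \<subseteq> S" for T
    using that
  proof (induction T rule: finite_induct)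
    case empty
    have "h e \<noteq> 0" by (rule edge) (auto simp: e_def)
    then show ?case by (simp add: zero_less_mult_iff linorder_neq_iff disj_commute)
  next
    case (insert k T)
    define D where "D = (\<lambda>j. if j \<in> T then 1 else e j)"
    have "D(k := 0) = D" using insert by (auto simp: D_def e_def)
    have "t * h (D(k := 1)) + (1 - t) * h (D(k := 0)) \<noteq> 0" if "0 \<le> t" "t \<le> 1" for t
    proof -
      have "h (D(k := t)) \<noteq> 0"
        by (rule edge[of k]) (use that insert in \<open>auto simp: D_def e_def\<close>)
      then show ?thesis using insert affine[of k D t] by simp
    qed
    then have "0 < h (D(k := 1)) * h D"
      using affine_same_sign \<open>D(k := 0) = D\<close> by metis
    moreover have "0 < h e * h D" using insert by (simp add: D_def)
    moreover have "D(k := 1) = (\<lambda>j. if j \<in> insert k T then 1 else e j)" by (auto simp: D_def)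
    ultimately show ?case by (auto simp: zero_less_mult_iff)
  qed
  \<comment> \<open>\<open>T\<close> collects the coordinates that may be fractional:
    \<open>T = {}\<close> is the case of vertices, \<open>T = S\<close> the whole cube.\<close>
  have "0 < h e * h D"
    if "finite T" "T \<subseteq> S" "\<forall>j\<in>S - T. D j \<in> {0, 1}" "\<forall>j\<in>T. D j \<in> {0..1}"
      "\<forall>j. j \<notin> S \<longrightarrow> D j = D0 j" for T D
    using that
  proof (induction T arbitrary: D rule: finite_induct)
    case empty
    have "D = (\<lambda>j. if j \<in> {j \<in> S. D j = 1} then 1 else e j)"
      using empty by (auto simp: e_def fun_eq_iff)
    then show ?case using vertex[of "{j \<in> S. D j = 1}"] S by auto
  next
    case (insert k T)
    have "0 < h e * h (D(k := 1))" "0 < h e * h (D(k := 0))"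
      by (rule insert.IH; use insert in auto)+
    moreover have "h D = D k * h (D(k := 1)) + (1 - D k) * h (D(k := 0))"
      using affine[of k D "D k"] insert.prems by simp
    then have "h e * h D = D k * (h e * h (D(k := 1))) + (1 - D k) * (h e * h (D(k := 0)))"
      by (simp only: distrib_left mult.left_commute)
    moreover have "0 \<le> D k" "D k \<le> 1" using insert by auto
    moreover have "0 < t * a + (1 - t) * b" if "0 < a" "0 < b" "0 \<le> t" "t \<le> 1" for a b t :: real
      using that by (cases "t = 0") (auto intro!: add_pos_nonneg)
    ultimately show ?case by simp
  qed
  from this[OF S subset_refl, of D] D show ?thesis by auto
qed

section \<open>Square matrices over a sum of index types\<close>

lemma sum_UNIV_Plus:
  fixes f :: "'n::finite + 'm::finite \<Rightarrow> 'a::comm_monoid_add"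
  shows "(\<Sum>a\<in>UNIV. f a) = (\<Sum>i\<in>UNIV. f (Inl i)) + (\<Sum>k\<in>UNIV. f (Inr k))"
  by (simp add: sum.Plus flip: UNIV_Plus_UNIV)

lemma det_row_affine:
  fixes A :: "'i::finite \<Rightarrow> real^'i"
  shows "det (\<chi> i. if i = k then t *s a + (1 - t) *s b else A i)
     = t * det (\<chi> i. if i = k then a else A i) + (1 - t) * det (\<chi> i. if i = k then b else A i)"
  using det_row_add[of k "\<lambda>_. t *s a" "\<lambda>_. (1 - t) *s b" A]
  by (simp add: det_row_mul[of k _ "\<lambda>_. a"] det_row_mul[of k _ "\<lambda>_. b"])

text \<open>A determinant needs one index type for rows and columns, so a pair \<open>(x, z)\<close>
  is flattened into a single vector.\<close>

definition sum_vec :: "real^'n \<Rightarrow> real^'m \<Rightarrow> real^('n + 'm)" where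
  "sum_vec x y = (\<chi> a. case a of Inl i \<Rightarrow> x $ i | Inr k \<Rightarrow> y $ k)"

lemma sum_vec_nth [simp]: "sum_vec x y $ Inl i = x $ i" "sum_vec x y $ Inr k = y $ k"
  by (simp_all add: sum_vec_def)

lemma vec_Plus_eq_iff:
  fixes v w :: "'a^('n::finite + 'm::finite)"
  shows "v = w \<longleftrightarrow> (\<forall>i. v $ Inl i = w $ Inl i) \<and> (\<forall>k. v $ Inr k = w $ Inr k)"
  by (simp add: vec_eq_iff split_sum_all)

lemma sum_vec_eq_0_iff [simp]: "sum_vec x y = 0 \<longleftrightarrow> x = 0 \<and> y = 0"
  by (simp add: vec_Plus_eq_iff vec_eq_iff)

lemma sum_vec_cases: obtains x y where "w = sum_vec x y"
  by (rule that[of "\<chi> i. w $ Inl i" "\<chi> k. w $ Inr k"])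
     (simp add: vec_Plus_eq_iff)

text \<open>The transpose of the matrix of
  \<open>(x, z) \<mapsto> (G *v x + B *v (D * z), C *v x - (1 - D) * z)\<close>; the entry \<open>D k\<close> occurs in one row only.\<close>

definition bordered ::
  "real^'n^'n \<Rightarrow> real^'m^'n \<Rightarrow> real^'n^'m \<Rightarrow> ('m \<Rightarrow> real) \<Rightarrow> real^('n + 'm)^('n + 'm)" where
  "bordered G B C D = (\<chi> a. case a of
      Inl i \<Rightarrow> sum_vec (column i G) (column i C)
    | Inr k \<Rightarrow> sum_vec (D k *\<^sub>R column k B) (- (1 - D k) *\<^sub>R axis k 1))"

lemma det_bordered_affine:
  fixes G :: "real^'n^'n" and B :: "real^'m^'n"
  shows "det (bordered G B C (D(k := t)))
    = t * det (bordered G B C (D(k := 1))) + (1 - t) * det (bordered G B C (D(k := 0)))"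
proof -
  define R where "R = (\<lambda>t. sum_vec (t *\<^sub>R column k B) (- (1 - t) *\<^sub>R axis k 1 :: real^'m))"
  have upd: "bordered G B C (D(k := t)) = (\<chi> i. if i = Inr k then R t else bordered G B C D $ i)" for t
    by (auto simp: vec_eq_iff bordered_def R_def split: sum.split)
  have "R t = t *s R 1 + (1 - t) *s R 0"
    by (auto simp: vec_eq_iff R_def sum_vec_def algebra_simps split: sum.split)
  then show ?thesis
    unfolding upd by (simp only: det_row_affine)
qed

text \<open>Kernel vectors of \<open>bordered\<close> are left kernel vectors of the system matrix.
  The second component shows that for 0 < \<open>D k\<close> < 1 the numbers
  \<open>column k B \<bullet> a\<close> and \<open>b $ k\<close> of a kernel vector have the same
  sign, which is where the inequalities of the criterion come from.\<close>

lemma bordered_mult_sum_vec: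
  "bordered G B C D *v sum_vec a b =
     sum_vec (transpose G *v a + transpose C *v b)
       (\<chi> k. D k * (column k B \<bullet> a) - (1 - D k) * b $ k)"
  by (auto simp: vec_Plus_eq_iff bordered_def matrix_vector_mult_def sum_UNIV_Plus transpose_def
      column_def inner_vec_def sum_distrib_left mult_ac axis_def if_distrib sum.delta algebra_simps cong: if_cong)

lemma transpose_bordered_mult_sum_vec:
  "transpose (bordered G B C D) *v sum_vec x z =
     sum_vec (G *v x + B *v (\<chi> k. D k * z $ k)) (C *v x - (\<chi> k. (1 - D k) * z $ k))"
  by (auto simp: vec_Plus_eq_iff bordered_def matrix_vector_mult_def sum_UNIV_Plus transpose_def
      column_def mult_ac axis_def if_distrib sum.delta algebra_simps cong: if_cong)

text \<open>The hypothesis concerns left kernels on the edges of the cube, the conclusion right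
  kernels on the whole cube. The determinant links them: it is invariant under transposition and
  affine in each \<open>D k\<close>.\<close>

lemma bordered_injective:
  fixes G :: "real^'n^'n" and B :: "real^'m^'n" and C :: "real^'n^'m"
  assumes edge: "\<And>D k a b. (\<forall>j\<in>S - {k}. D j \<in> {0, 1}) \<Longrightarrow> (k \<in> S \<longrightarrow> D k \<in> {0..1}) \<Longrightarrow>
      (\<forall>j. j \<notin> S \<longrightarrow> D j = D0 j) \<Longrightarrow> transpose G *v a + transpose C *v b = 0 \<Longrightarrow>
      (\<forall>j. D j * (column j B \<bullet> a) = (1 - D j) * b $ j) \<Longrightarrow> a = 0 \<and> b = 0"
    and D: "\<forall>j\<in>S. D j \<in> {0..1}" "\<forall>j. j \<notin> S \<longrightarrow> D j = D0 j"
    and ker: "G *v x + B *v (\<chi> k. D k * z $ k) = 0" "C *v x - (\<chi> k. (1 - D k) * z $ k) = 0"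
  shows "x = 0 \<and> z = 0"
proof -
  have "det (bordered G B C D) \<noteq> 0"
  proof (rule multiaffine_nonzero[of S "\<lambda>D. det (bordered G B C D)" D0])
    fix D' k assume D': "\<forall>j\<in>S - {k}. D' j \<in> {0, 1}" "k \<in> S \<longrightarrow> D' k \<in> {0..1}"
      "\<forall>j. j \<notin> S \<longrightarrow> D' j = D0 j"
    have "w = 0" if "bordered G B C D' *v w = 0" for w
    proof -
      obtain a b where w: "w = sum_vec a b" by (rule sum_vec_cases)
      have "transpose G *v a + transpose C *v b = 0"
        and "(\<chi> k. D' k * (column k B \<bullet> a) - (1 - D' k) * b $ k) = 0"
        using that unfolding w bordered_mult_sum_vec sum_vec_eq_0_iff by blast+
      then have "a = 0 \<and> b = 0"
        by (intro edge[OF D']) (simp_all add: vec_eq_iff)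
      then show ?thesis by (simp add: w)
    qed
    then have "\<exists>M. M ** bordered G B C D' = mat 1"
      by (subst matrix_left_invertible_ker) blast
    then show "det (bordered G B C D') \<noteq> 0"
      by (simp add: invertible_left_inverse flip: invertible_det_nz)
  qed (use D det_bordered_affine in auto)
  then have "det (transpose (bordered G B C D)) \<noteq> 0" by (simp add: det_transpose)
  then have "\<exists>M. M ** transpose (bordered G B C D) = mat 1"
    by (simp only: invertible_left_inverse flip: invertible_det_nz)
  moreover have "transpose (bordered G B C D) *v sum_vec x z = 0"
    unfolding transpose_bordered_mult_sum_vec using ker by simp
  ultimately have "sum_vec x z = 0" unfolding matrix_left_invertible_ker by blast
  then show ?thesis by simp
qed

section \<open>Parametric complementarity systems\<close>

text \<open>\<open>y\<close> is a multiplier and \<open>s\<close> a constraint value. Coordinate by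
  coordinate this says that \<open>s\<close> is normal at \<open>y\<close> to the polar of the
  product of the constraint cones.\<close>

definition complementary :: "'m set \<Rightarrow> real^'m \<Rightarrow> real^'m \<Rightarrow> bool" where
  "complementary E y s \<longleftrightarrow>
     (\<forall>k. if k \<in> E then s $ k = 0 else 0 \<le> y $ k \<and> s $ k \<le> 0 \<and> y $ k * s $ k = 0)"

definition proj_multiplier :: "'m set \<Rightarrow> real^'m \<Rightarrow> real^'m" where
  "proj_multiplier E z = (\<chi> k. if k \<in> E then z $ k else max (z $ k) 0)"

text \<open>An instance of the fact that \<open>s\<close> is normal to a closed convex set at
  \<open>y\<close> iff \<open>y\<close> is the projection of \<open>y + s\<close>; here everything
  reduces to one real coordinate.\<close>

lemma complementary_iff_proj_multiplier: "complementary E y s \<longleftrightarrow> proj_multiplier E (y + s) = y"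
proof -
  have "(0 \<le> a \<and> b \<le> 0 \<and> a * b = 0) \<longleftrightarrow> max (a + b) 0 = a" for a b :: real
    by (auto simp: max_def)
  then show ?thesis
    by (simp add: complementary_def proj_multiplier_def vec_eq_iff)
qed

lemma norm_proj_multiplier_diff_le:
  "norm (proj_multiplier E z - proj_multiplier E z') \<le> norm (z - z')"
  unfolding norm_vec_def by (rule L2_set_mono) (auto simp: proj_multiplier_def max_def)

lemma continuous_on_proj_multiplier: "continuous_on A (proj_multiplier E)"
  by (rule lipschitz_on_continuous_on[of 1])
     (auto intro!: lipschitz_onI simp: dist_norm norm_proj_multiplier_diff_le)

text \<open>The secants of a nondecreasing, nonexpansive function have slopes in [0, 1]. The last
  two clauses fix the slope where both points lie on the same smooth piece; near \<open>zbar\<close>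
  this leaves freedom at the weakly active indices only.\<close>

lemma proj_multiplier_difference_quotient:
  fixes z z' :: "real^'m"
  shows "\<exists>D :: real^'m. \<forall>k. D $ k \<in> {0..1} \<and>
    proj_multiplier E z $ k - proj_multiplier E z' $ k = D $ k * (z $ k - z' $ k) \<and>
    (k \<in> E \<or> (0 < z $ k \<and> 0 < z' $ k) \<longrightarrow> D $ k = 1) \<and> (k \<notin> E \<and> z $ k < 0 \<and> z' $ k < 0 \<longrightarrow> D $ k = 0)"
proof -
  have "\<exists>d. d \<in> {0..1} \<and> proj_multiplier E z $ k - proj_multiplier E z' $ k = d * (z $ k - z' $ k) \<and>
    (k \<in> E \<or> (0 < z $ k \<and> 0 < z' $ k) \<longrightarrow> d = 1) \<and> (k \<notin> E \<and> z $ k < 0 \<and> z' $ k < 0 \<longrightarrow> d = 0)" for k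
  proof (cases "k \<in> E \<or> (0 < z $ k \<and> 0 < z' $ k)")
    case True
    then show ?thesis by (intro exI[of _ 1]) (auto simp: proj_multiplier_def)
  next
    case F: False
    show ?thesis
    proof (cases "z $ k \<le> 0 \<and> z' $ k \<le> 0")
      case True
      then show ?thesis using F by (intro exI[of _ 0]) (auto simp: proj_multiplier_def)
    next
      case False
      with F consider "k \<notin> E" "0 < z $ k" "z' $ k \<le> 0" | "k \<notin> E" "z $ k \<le> 0" "0 < z' $ k"
        by linarith
      then show ?thesis
      proof cases
        case 1
        then show ?thesis
          \<comment> \<open>Only the positive one of the two values survives the projection, so the
            slope is its share of the difference.\<close>
          by (intro exI[of _ "z $ k / (z $ k - z' $ k)"]) (simp add: proj_multiplier_def)
      next
        case 2
        then show ?thesis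
          by (intro exI[of _ "z' $ k / (z' $ k - z $ k)"])
             (simp add: proj_multiplier_def divide_simps, simp add: algebra_simps)
      qed
    qed
  qed
  then have "\<forall>k. \<exists>d. d \<in> {0..1} \<and> proj_multiplier E z $ k - proj_multiplier E z' $ k = d * (z $ k - z' $ k) \<and>
    (k \<in> E \<or> (0 < z $ k \<and> 0 < z' $ k) \<longrightarrow> d = 1) \<and> (k \<notin> E \<and> z $ k < 0 \<and> z' $ k < 0 \<longrightarrow> d = 0)"
    by (rule allI)
  then show ?thesis by (simp only: lambda_skolem)
qed

definition critical_condition ::
  "'m set \<Rightarrow> 'm set \<Rightarrow> real^'n^'n \<Rightarrow> real^'m^'n \<Rightarrow> real^'n^'m \<Rightarrow> bool" where
  "critical_condition \<alpha> \<beta> G B C \<longleftrightarrow> (\<forall>A Z w1 w2.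
     \<alpha> \<subseteq> A \<and> A \<union> Z \<subseteq> \<alpha> \<union> \<beta> \<and> A \<inter> Z = {} \<and>
     transpose G *v w1 = (\<Sum>k\<in>A \<union> Z. w2 $ k *\<^sub>R row k C) \<and>
     (\<forall>k\<in>A. column k B \<bullet> w1 = 0) \<and> (\<forall>k\<in>Z. column k B \<bullet> w1 \<le> 0 \<and> 0 \<le> w2 $ k) \<longrightarrow>
     w1 = 0 \<and> (\<forall>k\<in>A \<union> Z. w2 $ k = 0))"

lemma critical_conditionD:
  assumes "critical_condition \<alpha> \<beta> G B C" "\<alpha> \<subseteq> A" "A \<union> Z \<subseteq> \<alpha> \<union> \<beta>" "A \<inter> Z = {}"
    "transpose G *v w1 = (\<Sum>k\<in>A \<union> Z. w2 $ k *\<^sub>R row k C)"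
    "\<And>k. k \<in> A \<Longrightarrow> column k B \<bullet> w1 = 0"
    "\<And>k. k \<in> Z \<Longrightarrow> column k B \<bullet> w1 \<le> 0" "\<And>k. k \<in> Z \<Longrightarrow> 0 \<le> w2 $ k"
  shows "w1 = 0 \<and> (\<forall>k\<in>A \<union> Z. w2 $ k = 0)"
  by (rule assms(1)[unfolded critical_condition_def, THEN spec, THEN spec, THEN spec, THEN spec,
        THEN mp]; intro conjI ballI assms(2-); assumption)

lemma transpose_mult_eq_sum_rows:
  fixes C :: "real^'n^'m"
  shows "transpose C *v b = (\<Sum>k\<in>UNIV. b $ k *\<^sub>R row k C)"
  by (simp add: vec_eq_iff matrix_vector_mult_def transpose_def row_def mult.commute
      del: transpose_matrix_vector)

text \<open>Only partitions whose middle part has at most one element matter here: they say that the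
  matrices at the two ends of an edge of the cube have determinants of the same sign.\<close>

lemma critical_condition_imp_injective:
  fixes G :: "real^'n^'n" and B :: "real^'m^'n" and C :: "real^'n^'m"
  assumes crit: "critical_condition \<alpha> \<beta> G B C" and disj: "\<alpha> \<inter> \<beta> = {}"
    and D: "\<And>k. D $ k \<in> {0..1}" "\<And>k. k \<in> \<alpha> \<Longrightarrow> D $ k = 1" "\<And>k. k \<notin> \<alpha> \<Longrightarrow> k \<notin> \<beta> \<Longrightarrow> D $ k = 0"
    and ker: "G *v x + B *v (D * z) = 0" "C *v x - (1 - D) * z = 0"
  shows "x = 0 \<and> z = 0"
proof (rule bordered_injective[of \<beta> "\<lambda>k. if k \<in> \<alpha> then 1 else 0" G C B "\<lambda>k. D $ k"])
  have "D * z = (\<chi> k. D $ k * z $ k)" "(1 - D) * z = (\<chi> k. (1 - D $ k) * z $ k)"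
    by (simp_all add: vec_eq_iff)
  with ker show "G *v x + B *v (\<chi> k. D $ k * z $ k) = 0" "C *v x - (\<chi> k. (1 - D $ k) * z $ k) = 0"
    by (simp_all only:)
next
  fix D :: "'m \<Rightarrow> real" and k a b
  assume D: "\<forall>j\<in>\<beta> - {k}. D j \<in> {0, 1}" "k \<in> \<beta> \<longrightarrow> D k \<in> {0..1}"
      "\<forall>j. j \<notin> \<beta> \<longrightarrow> D j = (if j \<in> \<alpha> then 1 else 0)"
    and ab: "transpose G *v a + transpose C *v b = 0"
      "\<forall>j. D j * (column j B \<bullet> a) = (1 - D j) * b $ j"
  \<comment> \<open>The slope decides the part: 1 means active with a free multiplier, a fractional
    value belongs to the middle part, and 0 covers both inactive indices and the remaining part of
    \<beta>.\<close>
  define A where "A = {j. D j = 1}"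
  define Z where "Z = {j. 0 < D j \<and> D j < 1}"
  have val: "(j \<in> \<beta> \<and> (D j = 0 \<or> D j = 1 \<or> (j = k \<and> 0 < D j \<and> D j < 1))) \<or>
      (j \<in> \<alpha> \<and> j \<notin> \<beta> \<and> D j = 1) \<or> (j \<notin> \<alpha> \<and> j \<notin> \<beta> \<and> D j = 0)" for j
  proof (cases "j \<in> \<beta>")
    case True
    show ?thesis
    proof (cases "j = k")
      case True
      then show ?thesis using \<open>j \<in> \<beta>\<close> D(2) by auto
    qed (use True D(1) in simp)
  qed (use D(3) in simp)
  have Z: "Z \<subseteq> {k}"
  proof
    fix j assume "j \<in> Z"
    then show "j \<in> {k}" using val[of j] by (auto simp: Z_def)
  qed
  have AZ: "\<alpha> \<subseteq> A" "A \<union> Z \<subseteq> \<alpha> \<union> \<beta>" "A \<inter> Z = {}"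
  proof -
    show "\<alpha> \<subseteq> A"
    proof
      fix j assume "j \<in> \<alpha>"
      then show "j \<in> A" using val[of j] disj by (auto simp: A_def)
    qed
    show "A \<union> Z \<subseteq> \<alpha> \<union> \<beta>"
    proof
      fix j assume "j \<in> A \<union> Z"
      then show "j \<in> \<alpha> \<union> \<beta>" using val[of j] by (auto simp: A_def Z_def)
    qed
    show "A \<inter> Z = {}" by (auto simp: A_def Z_def)
  qed
  have off: "b $ j = 0" if "j \<notin> A \<union> Z" for j
  proof -
    have "D j = 0" using that val[of j] by (auto simp: A_def Z_def)
    then show ?thesis using ab(2)[rule_format, of j] by simp
  qed
  have onA: "column j B \<bullet> a = 0" if "j \<in> A" for j
    using that ab(2)[rule_format, of j] by (simp add: A_def)
  have "transpose C *v b = (\<Sum>j\<in>A \<union> Z. b $ j *\<^sub>R row j C)"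
    unfolding transpose_mult_eq_sum_rows by (rule sum.mono_neutral_right) (use off in auto)
  \<comment> \<open>The kernel equation has both terms on one side, so the multiplier vector
    belonging to \<open>a\<close> is \<open>- b\<close>.\<close>
  then have eq: "transpose G *v a = (\<Sum>j\<in>A \<union> Z. (- b) $ j *\<^sub>R row j C)"
    using ab(1) by (simp add: sum_negf eq_neg_iff_add_eq_0)
  show "a = 0 \<and> b = 0"
  \<comment> \<open>\<open>Z\<close> has at most one index, and there
    \<open>column j B \<bullet> a\<close> and \<open>b $ j\<close> have the same sign. One global
    change of sign thus suffices: \<open>(a, - b)\<close> or \<open>(- a, b)\<close> meets the
    inequalities of the criterion. With several fractional indices the signs could conflict.\<close>
  proof (cases "\<forall>j\<in>Z. b $ j \<le> 0")
    case True
    have "column j B \<bullet> a \<le> 0" if "j \<in> Z" for j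
    proof -
      have "D j * (column j B \<bullet> a) \<le> 0"
        using ab(2)[rule_format, of j] that True by (simp add: Z_def mult_nonneg_nonpos)
      then show ?thesis using that by (simp add: Z_def mult_le_0_iff)
    qed
    then have "a = 0 \<and> (\<forall>j\<in>A \<union> Z. (- b) $ j = 0)"
      using True by (intro critical_conditionD[OF crit AZ eq onA]) simp_all
    then have "a = 0" "b $ j = 0" for j using off[of j] by auto
    then show ?thesis by (simp add: vec_eq_iff)
  next
    case False
    then have pos: "\<And>j. j \<in> Z \<Longrightarrow> b $ j \<ge> 0" using Z
      by (metis insertE empty_iff linorder_linear subsetD)
    have neg: "column j B \<bullet> (- a) \<le> 0" if "j \<in> Z" for j
    proof -
      have "D j * (column j B \<bullet> a) \<ge> 0"
        using ab(2)[rule_format, of j] that pos by (simp add: Z_def)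
      then show ?thesis using that by (simp add: Z_def zero_le_mult_iff)
    qed
    have "transpose G *v (- a) = (\<Sum>j\<in>A \<union> Z. b $ j *\<^sub>R row j C)"
      using eq by (simp add: sum_negf vec.neg del: transpose_matrix_vector)
    then have "- a = 0 \<and> (\<forall>j\<in>A \<union> Z. b $ j = 0)"
      using onA neg pos by (intro critical_conditionD[OF crit AZ]) simp_all
    then have "a = 0" "b $ j = 0" for j using off[of j] by auto
    then show ?thesis by (simp add: vec_eq_iff)
  qed
next
  show "\<forall>j\<in>\<beta>. D $ j \<in> {0..1}" using D(1) by blast
  show "\<forall>j. j \<notin> \<beta> \<longrightarrow> D $ j = (if j \<in> \<alpha> then 1 else 0)" using D(2,3) by simp
qed

text \<open>Injectivity for each admissible \<open>D\<close> becomes uniform because the norm of the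
  image attains a positive minimum over the compact product of the set of all \<open>D\<close> with
  the unit sphere; homogeneity extends the bound to all \<open>(x, z)\<close>.\<close>

lemma critical_condition_imp_uniform_bound:
  fixes G :: "real^'n^'n" and B :: "real^'m^'n" and C :: "real^'n^'m"
  assumes crit: "critical_condition \<alpha> \<beta> G B C" and disj: "\<alpha> \<inter> \<beta> = {}"
  shows "\<exists>c>0. \<forall>D x z.
    (\<forall>k. D $ k \<in> {0..1} \<and> (k \<in> \<alpha> \<longrightarrow> D $ k = 1) \<and> (k \<notin> \<alpha> \<and> k \<notin> \<beta> \<longrightarrow> D $ k = 0)) \<longrightarrow>
    c * norm (x, z) \<le> norm (G *v x + B *v (D * z), C *v x - (1 - D) * z)"
proof -
  \<comment> \<open>The admissible \<open>D\<close> form a box that is degenerate in all coordinates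
    outside \<beta>, hence a compact set.\<close>
  define lo hi :: "real^'m" where "lo = (\<chi> k. if k \<in> \<alpha> then 1 else 0)"
    and "hi = (\<chi> k. if k \<in> \<alpha> \<union> \<beta> then 1 else 0)"
  define M where "M = (\<lambda>(D, x, z). (G *v x + B *v (D * z), C *v x - (1 - D) * z))"
  define K where "K = cbox lo hi \<times> sphere (0 :: (real^'n) \<times> (real^'m)) 1"
  have "(lo $ k \<le> D $ k \<and> D $ k \<le> hi $ k) \<longleftrightarrow> (D $ k \<in> {0..1} \<and> (k \<in> \<alpha> \<longrightarrow> D $ k = 1) \<and>
      (k \<notin> \<alpha> \<and> k \<notin> \<beta> \<longrightarrow> D $ k = 0))" for D k
    by (cases "k \<in> \<alpha>"; cases "k \<in> \<beta>") (auto simp: lo_def hi_def)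
  then have box: "D \<in> cbox lo hi \<longleftrightarrow> (\<forall>k. D $ k \<in> {0..1} \<and> (k \<in> \<alpha> \<longrightarrow> D $ k = 1) \<and>
      (k \<notin> \<alpha> \<and> k \<notin> \<beta> \<longrightarrow> D $ k = 0))" for D
    by (simp add: mem_box_cart)
  have "continuous_on K M"
    unfolding M_def case_prod_unfold times_vec_def
    by (intro continuous_intros continuous_on_vec_lambda
        bounded_linear.continuous_on[OF matrix_vector_mul_bounded_linear])
  then have cont: "continuous_on K (\<lambda>q. norm (M q))" by (rule continuous_on_norm)
  have "compact K" unfolding K_def by (intro compact_Times compact_cbox compact_sphere)
  moreover have "lo \<in> cbox lo hi" by (simp add: mem_box_cart lo_def hi_def)
  then have "K \<noteq> {}" unfolding K_def by (auto simp: sphere_eq_empty)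
  ultimately obtain q where q: "q \<in> K" "\<And>q'. q' \<in> K \<Longrightarrow> norm (M q) \<le> norm (M q')"
    using continuous_attains_inf[OF _ _ cont] by blast
  obtain D0 x0 z0 where q0: "q = (D0, x0, z0)" by (cases q)
  show ?thesis
  proof (intro exI[of _ "norm (M q)"] conjI allI impI)
    have "M q \<noteq> 0"
    proof
      assume "M q = 0"
      then have "x0 = 0 \<and> z0 = 0"
        using q(1) unfolding q0 K_def M_def
        by (intro critical_condition_imp_injective[OF crit disj, of D0]) (simp_all add: box zero_prod_def)
      then show False using q(1) by (auto simp: q0 K_def)
    qed
    then show "norm (M q) > 0" by simp
    fix D :: "real^'m" and x z
    assume D: "\<forall>k. D $ k \<in> {0..1} \<and> (k \<in> \<alpha> \<longrightarrow> D $ k = 1) \<and> (k \<notin> \<alpha> \<and> k \<notin> \<beta> \<longrightarrow> D $ k = 0)"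
    show "norm (M q) * norm (x, z) \<le> norm (G *v x + B *v (D * z), C *v x - (1 - D) * z)"
    proof (cases "(x, z) = 0")
      case False
      define r where "r = norm (x, z)"
      have "r > 0" unfolding r_def zero_less_norm_iff by (rule False)
      have "norm (M q) \<le> norm (M (D, x /\<^sub>R r, z /\<^sub>R r))"
      proof (rule q(2))
        have "norm ((x, z) /\<^sub>R r) = 1" using \<open>r > 0\<close> unfolding norm_scaleR r_def[symmetric] by simp
        then show "(D, x /\<^sub>R r, z /\<^sub>R r) \<in> K" using D by (simp add: K_def box)
      qed
      also have "M (D, x /\<^sub>R r, z /\<^sub>R r) = M (D, x, z) /\<^sub>R r"
        by (simp add: M_def algebra_simps matrix_vector_mult_scaleR)
      finally show ?thesis
        using \<open>r > 0\<close> unfolding norm_scaleR r_def[symmetric]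
        by (simp add: M_def pos_le_divide_eq flip: divide_inverse_commute)
    qed (simp add: zero_prod_def)
  qed
qed

section \<open>Local analysis of an abstract complementarity system\<close>

lemma strict_derivative_continuous_on:
  assumes "strict_derivative h L a"
  obtains d where "d > 0" "continuous_on (ball a d) h"
proof -
  obtain d K where d: "d > 0" "K > 0"
    "\<And>x z. x \<in> ball a d \<Longrightarrow> z \<in> ball a d \<Longrightarrow> norm (h x - h z) \<le> K * norm (x - z)"
    using strict_derivative_lipschitz[OF assms] by blast
  then have "K-lipschitz_on (ball a d) h"
    by (intro lipschitz_onI) (simp_all add: dist_norm)
  then show thesis using that[OF d(1)] lipschitz_on_continuous_on by blast
qed

lemma strict_derivative_tendsto:
  assumes "strict_derivative h L a" "(g \<longlongrightarrow> a) net"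
  shows "((\<lambda>x. h (g x)) \<longlongrightarrow> h a) net"
  by (rule isCont_tendsto_compose[OF _ assms(2)])
     (rule has_derivative_continuous[OF strict_derivative_imp_has_derivative[OF assms(1)]])

lemma nonpos_if_le_arbitrary_multiple:
  fixes N c :: real
  assumes "\<And>e. e > 0 \<Longrightarrow> N \<le> e * c" and "c \<ge> 0"
  shows "N \<le> 0"
proof (rule ccontr)
  assume "\<not> N \<le> 0"
  then have "N \<le> N / (2 * (c + 1)) * c" using assms by (intro assms(1)) auto
  then have "N * (c + 2) \<le> 0" using assms(2) by (simp add: field_simps)
  then show False using \<open>\<not> N \<le> 0\<close> assms(2) by (auto simp: mult_le_0_iff)
qed

text \<open>What remains of the game after linearization: \<open>L\<close> stacks the partial
  Lagrangian gradients and \<open>F\<close> the constraints. The parameters \<open>v\<close> and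
  \<open>u\<close> only shift right-hand sides, so they occur in \<open>solutions\<close> and not in
  the data.\<close>

locale complementarity_system =
  fixes L :: "(real^'n) \<times> (real^'m) \<times> 'w::euclidean_space \<Rightarrow> real^'n"
    and F :: "(real^'n) \<times> 'w \<Rightarrow> real^'m"
    and E :: "'m set"
    and xbar :: "real^'n" and ybar :: "real^'m" and wbar :: 'w
    and G :: "real^'n^'n" and B :: "real^'m^'n" and C :: "real^'n^'m"
    and Lw :: "'w \<Rightarrow> real^'n" and Fw :: "'w \<Rightarrow> real^'m"
  assumes L_deriv: "strict_derivative L (\<lambda>(dx, dy, dw). G *v dx + B *v dy + Lw dw) (xbar, ybar, wbar)"
    and F_deriv: "strict_derivative F (\<lambda>(dx, dw). C *v dx + Fw dw) (xbar, wbar)"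
    and stationary: "L (xbar, ybar, wbar) = 0"
    and compl: "complementary E ybar (F (xbar, wbar))"
begin

definition solutions :: "'w \<times> (real^'n) \<times> (real^'m) \<Rightarrow> ((real^'n) \<times> (real^'m)) set" where
  "solutions = (\<lambda>(w, v, u). {(x, y). L (x, y, w) = v \<and> complementary E y (F (x, w) - u)})"

definition strongly_active :: "'m set" where
  "strongly_active = E \<union> {k. k \<notin> E \<and> F (xbar, wbar) $ k = 0 \<and> 0 < ybar $ k}"

definition weakly_active :: "'m set" where
  "weakly_active = {k. k \<notin> E \<and> F (xbar, wbar) $ k = 0 \<and> ybar $ k = 0}"

definition zbar :: "real^'m" where
  "zbar = ybar + F (xbar, wbar)"

text \<open>Carrying \<open>w\<close> along as a component gives domain and target the same
  dimension, as invariance of domain requires.\<close>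

definition normal_map :: "(real^'n) \<times> (real^'m) \<times> 'w \<Rightarrow> 'w \<times> (real^'n) \<times> (real^'m)" where
  "normal_map = (\<lambda>(x, z, w).
     (w, L (x, proj_multiplier E z, w), F (x, w) - (z - proj_multiplier E z)))"

lemma active_disjoint: "strongly_active \<inter> weakly_active = {}"
  by (auto simp: strongly_active_def weakly_active_def)

lemma proj_zbar: "proj_multiplier E zbar = ybar"
  using compl unfolding complementary_iff_proj_multiplier zbar_def .

lemma normal_map_bar: "normal_map (xbar, zbar, wbar) = (wbar, 0, 0)"
  by (simp add: normal_map_def proj_zbar stationary) (simp add: zbar_def)

lemma zbar_pos: "k \<in> strongly_active \<Longrightarrow> k \<in> E \<or> 0 < zbar $ k"
  by (auto simp: strongly_active_def zbar_def)

lemma inactive: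
  assumes "k \<notin> strongly_active" "k \<notin> weakly_active"
  shows "k \<notin> E" "F (xbar, wbar) $ k < 0" "ybar $ k = 0"
  using assms compl[unfolded complementary_def, rule_format, of k]
  by (auto simp: strongly_active_def weakly_active_def order_less_le)

lemma active:
  assumes "k \<in> strongly_active \<union> weakly_active"
  shows "F (xbar, wbar) $ k = 0"
  using assms compl[unfolded complementary_def, rule_format, of k]
  by (auto simp: strongly_active_def weakly_active_def)

lemma normal_map_imp_solution:
  assumes "normal_map (x, z, w) = (w', v, u)"
  shows "(x, proj_multiplier E z) \<in> solutions (w', v, u)"
proof -
  have eq: "w' = w" "v = L (x, proj_multiplier E z, w)" "F (x, w) - u = z - proj_multiplier E z"
    using assms by (auto simp: normal_map_def)
  show ?thesis by (simp add: solutions_def eq complementary_iff_proj_multiplier)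
qed

lemma solution_imp_normal_map:
  assumes "(x, y) \<in> solutions (w, v, u)"
  shows "normal_map (x, y + F (x, w) - u, w) = (w, v, u)"
    and "proj_multiplier E (y + F (x, w) - u) = y"
  using assms by (simp_all add: solutions_def normal_map_def complementary_iff_proj_multiplier add_diff_eq)

lemma normal_map_tendsto:
  assumes "(q \<longlongrightarrow> (xbar, zbar, wbar)) net"
  shows "((\<lambda>t. (fst (q t), proj_multiplier E (fst (snd (q t))), snd (snd (q t)))) \<longlongrightarrow> (xbar, ybar, wbar)) net"
    and "((\<lambda>t. (fst (q t), snd (snd (q t)))) \<longlongrightarrow> (xbar, wbar)) net"
proof -
  have "isCont (proj_multiplier E) zbar"
    using continuous_on_proj_multiplier[of UNIV E] by (simp add: continuous_on_eq_continuous_at)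
  moreover have q: "((\<lambda>t. fst (q t)) \<longlongrightarrow> xbar) net" "((\<lambda>t. fst (snd (q t))) \<longlongrightarrow> zbar) net"
    "((\<lambda>t. snd (snd (q t))) \<longlongrightarrow> wbar) net"
    using tendsto_fst[OF assms] tendsto_fst[OF tendsto_snd[OF assms]] tendsto_snd[OF tendsto_snd[OF assms]]
    by simp_all
  ultimately have "((\<lambda>t. proj_multiplier E (fst (snd (q t)))) \<longlongrightarrow> ybar) net"
    using isCont_tendsto_compose[of zbar "proj_multiplier E"] proj_zbar by simp
  then show "((\<lambda>t. (fst (q t), proj_multiplier E (fst (snd (q t))), snd (snd (q t)))) \<longlongrightarrow> (xbar, ybar, wbar)) net"
    "((\<lambda>t. (fst (q t), snd (snd (q t)))) \<longlongrightarrow> (xbar, wbar)) net"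
    by (intro tendsto_Pair q; assumption)+
qed

text \<open>A Lipschitz estimate for the inverse: after the exact secant \<open>D\<close> replaces
  the projection, the uniform lower bound for the linear part dominates the errors of the strict
  derivatives, and the dependence on \<open>w\<close> is charged to the first component of the
  normal map.\<close>

lemma normal_map_expansion:
  assumes crit: "critical_condition strongly_active weakly_active G B C"
  obtains S K where "open S" "(xbar, zbar, wbar) \<in> S" "K > 0" "continuous_on S normal_map"
    "\<And>x z w x' z' w'. (x, z, w) \<in> S \<Longrightarrow> (x', z', w') \<in> S \<Longrightarrow>
      norm (x - x', z - z') \<le> K * norm (normal_map (x, z, w) - normal_map (x', z', w'))"
proof -
  let ?P = "proj_multiplier E"
  obtain c where c: "c > 0" "\<forall>D x z.
      (\<forall>k. D $ k \<in> {0..1} \<and> (k \<in> strongly_active \<longrightarrow> D $ k = 1) \<and>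
        (k \<notin> strongly_active \<and> k \<notin> weakly_active \<longrightarrow> D $ k = 0)) \<longrightarrow>
      c * norm (x, z) \<le> norm (G *v x + B *v (D * z), C *v x - (1 - D) * z)"
    using critical_condition_imp_uniform_bound[OF crit active_disjoint] by blast
  have "bounded_linear (\<lambda>dw. G *v 0 + B *v 0 + Lw dw)"
    using bounded_linear_compose[OF strict_derivative_bounded_linear[OF L_deriv],
        of "\<lambda>dw. (0, 0, dw)"] by (simp add: bounded_linear_Pair)
  then obtain a where a: "a > 0" "\<And>dw. norm (Lw dw) \<le> norm dw * a"
    using bounded_linear.pos_bounded[of Lw] by auto
  have "bounded_linear (\<lambda>dw. C *v 0 + Fw dw)"
    using bounded_linear_compose[OF strict_derivative_bounded_linear[OF F_deriv],
        of "\<lambda>dw. (0, dw)"] by (simp add: bounded_linear_Pair)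
  then obtain b where b: "b > 0" "\<And>dw. norm (Fw dw) \<le> norm dw * b"
    using bounded_linear.pos_bounded[of Fw] by auto
  \<comment> \<open>The two linearization errors add up to at most
    \<open>c / 6 * (3 * n + 2 * norm dw)\<close>, so half of the lower bound \<open>c * n\<close>
    survives them.\<close>
  have e: "c / 6 > 0" using c(1) by simp
  obtain d1 where d1: "d1 > 0" "\<forall>p\<in>ball (xbar, ybar, wbar) d1. \<forall>p'\<in>ball (xbar, ybar, wbar) d1.
      norm (L p - L p' - (\<lambda>(dx, dy, dw). G *v dx + B *v dy + Lw dw) (p - p')) \<le> c / 6 * norm (p - p')"
    using strict_derivativeD[OF L_deriv e] by blast
  obtain d2 where d2: "d2 > 0" "\<forall>p\<in>ball (xbar, wbar) d2. \<forall>p'\<in>ball (xbar, wbar) d2.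
      norm (F p - F p' - (\<lambda>(dx, dw). C *v dx + Fw dw) (p - p')) \<le> c / 6 * norm (p - p')"
    using strict_derivativeD[OF F_deriv e] by blast
  obtain d3 where d3: "d3 > 0" "continuous_on (ball (xbar, ybar, wbar) d3) L"
    using strict_derivative_continuous_on[OF L_deriv] .
  obtain d4 where d4: "d4 > 0" "continuous_on (ball (xbar, wbar) d4) F"
    using strict_derivative_continuous_on[OF F_deriv] .
  define \<phi> where "\<phi> = (\<lambda>q :: (real^'n) \<times> (real^'m) \<times> 'w. (fst q, ?P (fst (snd q)), snd (snd q)))"
  define \<psi> where "\<psi> = (\<lambda>q :: (real^'n) \<times> (real^'m) \<times> 'w. (fst q, snd (snd q)))"
  define N where "N = nhds (xbar, zbar, wbar)"
  have id: "((\<lambda>q. q) \<longlongrightarrow> (xbar, zbar, wbar)) N" unfolding N_def by (rule filterlim_ident)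
  have near_L: "\<forall>\<^sub>F q in N. \<phi> q \<in> ball (xbar, ybar, wbar) (min d1 d3)"
  proof (rule topological_tendstoD)
    show "(\<phi> \<longlongrightarrow> (xbar, ybar, wbar)) N" using normal_map_tendsto(1)[OF id] by (simp only: \<phi>_def)
  qed (use d1(1) d3(1) in auto)
  have near_F: "\<forall>\<^sub>F q in N. \<psi> q \<in> ball (xbar, wbar) (min d2 d4)"
  proof (rule topological_tendstoD)
    show "(\<psi> \<longlongrightarrow> (xbar, wbar)) N" using normal_map_tendsto(2)[OF id] by (simp only: \<psi>_def)
  qed (use d2(1) d4(1) in auto)
  have z: "((\<lambda>q. fst (snd q) $ k) \<longlongrightarrow> zbar $ k) N" for k
    using tendsto_vec_nth[OF tendsto_fst[OF tendsto_snd[OF id]], of k] by simp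
  \<comment> \<open>Nonzero coordinates of \<open>zbar\<close> keep their sign near it, which pins
    the slopes outside the weakly active set.\<close>
  have near_z: "\<forall>\<^sub>F q in N. \<forall>k. (0 < zbar $ k \<longrightarrow> 0 < fst (snd q) $ k) \<and> (zbar $ k < 0 \<longrightarrow> fst (snd q) $ k < 0)"
  proof (intro eventually_all_finite)
    fix k
    have "\<forall>\<^sub>F q in N. 0 < zbar $ k \<longrightarrow> 0 < fst (snd q) $ k"
      by (cases "0 < zbar $ k") (simp_all add: order_tendstoD(1)[OF z])
    moreover have "\<forall>\<^sub>F q in N. zbar $ k < 0 \<longrightarrow> fst (snd q) $ k < 0"
      by (cases "zbar $ k < 0") (simp_all add: order_tendstoD(2)[OF z])
    ultimately show "\<forall>\<^sub>F q in N. (0 < zbar $ k \<longrightarrow> 0 < fst (snd q) $ k) \<and>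
        (zbar $ k < 0 \<longrightarrow> fst (snd q) $ k < 0)"
      by (rule eventually_conj)
  qed
  obtain S where S: "open S" "(xbar, zbar, wbar) \<in> S"
    "\<forall>q\<in>S. \<phi> q \<in> ball (xbar, ybar, wbar) (min d1 d3) \<and> \<psi> q \<in> ball (xbar, wbar) (min d2 d4) \<and>
      (\<forall>k. (0 < zbar $ k \<longrightarrow> 0 < fst (snd q) $ k) \<and> (zbar $ k < 0 \<longrightarrow> fst (snd q) $ k < 0))"
    using eventually_conj[OF near_L eventually_conj[OF near_F near_z]]
    unfolding N_def eventually_nhds by blast
  have "continuous_on S normal_map"
  proof -
    have "normal_map = (\<lambda>q. (snd (snd q), L (\<phi> q), F (\<psi> q) - (fst (snd q) - ?P (fst (snd q)))))"
      by (simp add: fun_eq_iff normal_map_def \<phi>_def \<psi>_def)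
    moreover have P: "continuous_on S (\<lambda>q. ?P (fst (snd q)))"
      by (rule continuous_on_compose2[OF continuous_on_proj_multiplier[of UNIV]])
         (auto intro!: continuous_intros)
    have "continuous_on S (\<lambda>q. L (\<phi> q))"
      by (rule continuous_on_compose2[OF d3(2)])
         (use S(3) in \<open>auto simp: \<phi>_def intro!: continuous_intros P\<close>)
    moreover have "continuous_on S (\<lambda>q. F (\<psi> q))"
      by (rule continuous_on_compose2[OF d4(2)])
         (use S(3) in \<open>auto simp: \<psi>_def intro!: continuous_intros\<close>)
    ultimately show ?thesis by (auto intro!: continuous_intros P)
  qed
  \<comment> \<open>In the bracket, 2 stands for the last two components of the normal map,
    \<open>c / 3\<close> for the errors in \<open>dw\<close>, and \<open>a\<close>, \<open>b\<close>
    for the bounds of \<open>Lw\<close>, \<open>Fw\<close>; the factor \<open>2 / c\<close> comes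
    from absorbing half of \<open>c * n\<close>.\<close>
  define K where "K = 2 * (2 + c / 3 + a + b) / c"
  have "K > 0" using a(1) b(1) c(1) by (auto simp: K_def)
  show thesis
  proof (rule that[OF S(1,2) \<open>K > 0\<close> \<open>continuous_on S normal_map\<close>])
    fix x z w x' z' w'
    assume q: "(x, z, w) \<in> S" "(x', z', w') \<in> S"
    let ?H = "normal_map (x, z, w) - normal_map (x', z', w')"
    define dx dz dw dy where "dx = x - x'" "dz = z - z'" "dw = w - w'" "dy = ?P z - ?P z'"
    define dv dF where "dv = L (x, ?P z, w) - L (x', ?P z', w')" "dF = F (x, w) - F (x', w')"
    define n where "n = norm (dx, dz)"
    note defs = dx_dz_dw_dy_def dv_dF_def
    have H: "?H = (dw, dv, dF - (dz - dy))"
      by (simp add: normal_map_def defs)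
    have H_le: "norm dw \<le> norm ?H" "norm dv \<le> norm ?H" "norm (dF - (dz - dy)) \<le> norm ?H"
      unfolding H using norm_fst_le[of dw "(dv, dF - (dz - dy))"] norm_snd_le[of "(dv, dF - (dz - dy))" dw]
        norm_fst_le[of dv "dF - (dz - dy)"] norm_snd_le[of "dF - (dz - dy)" dv] by linarith+
    have n: "norm dx \<le> n" "norm dz \<le> n" unfolding n_def by (rule norm_fst_le norm_snd_le)+
    have dy: "norm dy \<le> n"
      using norm_proj_multiplier_diff_le[of E z z'] n(2) by (simp add: defs)
    obtain D :: "real^'m" where D: "\<forall>k. D $ k \<in> {0..1} \<and>
        ?P z $ k - ?P z' $ k = D $ k * (z $ k - z' $ k) \<and>
        (k \<in> E \<or> (0 < z $ k \<and> 0 < z' $ k) \<longrightarrow> D $ k = 1) \<and>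
        (k \<notin> E \<and> z $ k < 0 \<and> z' $ k < 0 \<longrightarrow> D $ k = 0)"
      using proj_multiplier_difference_quotient by blast
    have dyD: "dy = D * dz" using D by (simp add: vec_eq_iff defs)
    have "norm (dv - (G *v dx + B *v dy + Lw dw)) \<le> c / 6 * norm (dx, dy, dw)"
      using d1(2)[rule_format, of "\<phi> (x, z, w)" "\<phi> (x', z', w')"] bspec[OF S(3) q(1)] bspec[OF S(3) q(2)]
      by (simp add: \<phi>_def defs)
    also have "\<dots> \<le> c / 6 * (n + n + norm dw)"
      using norm_Pair_le[of dx "(dy, dw)"] norm_Pair_le[of dy dw] n dy c(1)
      by (intro mult_left_mono) auto
    finally have eL: "norm (dv - (G *v dx + B *v dy + Lw dw)) \<le> c / 6 * (n + n + norm dw)" .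
    have "norm (dF - (C *v dx + Fw dw)) \<le> c / 6 * norm (dx, dw)"
      using d2(2)[rule_format, of "\<psi> (x, z, w)" "\<psi> (x', z', w')"] bspec[OF S(3) q(1)] bspec[OF S(3) q(2)]
      by (simp add: \<psi>_def defs)
    also have "\<dots> \<le> c / 6 * (n + norm dw)"
      using norm_Pair_le[of dx dw] n c(1) by (intro mult_left_mono) auto
    finally have eF: "norm (dF - (C *v dx + Fw dw)) \<le> c / 6 * (n + norm dw)" .
    have "norm (G *v dx + B *v dy) \<le> norm dv + norm (dv - (G *v dx + B *v dy + Lw dw)) + norm (Lw dw)"
      using norm_triangle_ineq4[of "dv - (dv - (G *v dx + B *v dy + Lw dw))" "Lw dw"]
        norm_triangle_ineq4[of dv "dv - (G *v dx + B *v dy + Lw dw)"] by simp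
    moreover have "norm (C *v dx - (dz - dy)) \<le>
        norm (dF - (dz - dy)) + norm (dF - (C *v dx + Fw dw)) + norm (Fw dw)"
      using norm_triangle_ineq4[of "dF - (dz - dy) - (dF - (C *v dx + Fw dw))" "Fw dw"]
        norm_triangle_ineq4[of "dF - (dz - dy)" "dF - (C *v dx + Fw dw)"] by (simp add: algebra_simps)
    moreover have "c * n \<le> norm (G *v dx + B *v dy) + norm (C *v dx - (dz - dy))"
    proof -
      have "c * n \<le> norm (G *v dx + B *v (D * dz), C *v dx - (1 - D) * dz)"
        unfolding n_def
      proof (rule c(2)[rule_format], intro conjI impI; (elim conjE)?)
        fix k
        show "D $ k \<in> {0..1}" using D by blast
        show "D $ k = 1" if "k \<in> strongly_active"
        proof -
          have "k \<in> E \<or> (0 < z $ k \<and> 0 < z' $ k)"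
            using zbar_pos[OF that] bspec[OF S(3) q(1)] bspec[OF S(3) q(2)] by auto
          then show ?thesis using D by blast
        qed
        show "D $ k = 0" if "k \<notin> strongly_active" "k \<notin> weakly_active"
        proof -
          have "zbar $ k < 0" using inactive[OF that] by (simp add: zbar_def)
          then have "k \<notin> E \<and> z $ k < 0 \<and> z' $ k < 0"
            using inactive(1)[OF that] bspec[OF S(3) q(1)] bspec[OF S(3) q(2)] by auto
          then show ?thesis using D by blast
        qed
      qed
      also have "(1 - D) * dz = dz - dy" by (simp add: dyD vec_eq_iff algebra_simps)
      also have "norm (G *v dx + B *v (D * dz), C *v dx - (dz - dy)) \<le>
          norm (G *v dx + B *v dy) + norm (C *v dx - (dz - dy))"
        unfolding dyD by (rule norm_Pair_le)
      finally show ?thesis .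
    qed
    moreover note eL eF a(2)[of dw] b(2)[of dw] H_le
    ultimately have "c * n \<le> 2 * norm ?H + c / 6 * (3 * n + 2 * norm dw) + (a + b) * norm dw"
      by (simp add: algebra_simps)
    then have "c * n / 2 \<le> 2 * norm ?H + (c / 3 + a + b) * norm dw"
      by (simp add: algebra_simps)
    also have "\<dots> \<le> 2 * norm ?H + (c / 3 + a + b) * norm ?H"
      using H_le(1) a(1) b(1) c(1) by (intro add_left_mono mult_left_mono) auto
    finally have "c * n / 2 \<le> (2 + c / 3 + a + b) * norm ?H" by (simp add: algebra_simps)
    then have "n \<le> K * norm ?H" using c(1) by (simp add: K_def field_simps)
    then show "norm (x - x', z - z') \<le> K * norm ?H" by (simp add: n_def defs)
  qed
qed

lemma solutions_localization:
  assumes crit: "critical_condition strongly_active weakly_active G B C"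
  shows "has_lipschitz_localization solutions (wbar, 0, 0) (xbar, ybar)"
proof -
  let ?P = "proj_multiplier E"
  obtain S K where S: "open S" "(xbar, zbar, wbar) \<in> S" "K > 0" "continuous_on S normal_map"
    "\<forall>x z w x' z' w'. (x, z, w) \<in> S \<longrightarrow> (x', z', w') \<in> S \<longrightarrow>
      norm (x - x', z - z') \<le> K * norm (normal_map (x, z, w) - normal_map (x', z', w'))"
    using normal_map_expansion[OF crit] by blast
  \<comment> \<open>The expansion estimate separates \<open>x\<close> and \<open>z\<close>;
    \<open>w\<close> is read off from the first component of the value.\<close>
  have inj: "inj_on normal_map S"
  proof (rule inj_onI)
    fix q q' assume q: "q \<in> S" "q' \<in> S" "normal_map q = normal_map q'"
    obtain x z w x' z' w' where qq: "q = (x, z, w)" "q' = (x', z', w')" by (metis prod_cases3)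
    have "norm (x - x', z - z') \<le> 0"
      using S(5)[rule_format, of x z w x' z' w'] q unfolding qq by simp
    moreover have "w = w'" using q(3) by (simp add: qq normal_map_def)
    ultimately show "q = q'" by (simp add: qq zero_prod_def)
  qed
  define W where "W = normal_map ` S"
  have "open W"
    unfolding W_def by (rule invariance_of_domain_gen[OF S(1) S(4) inj]) simp
  define T where "T = the_inv_into S normal_map"
  have T: "T p \<in> S" "normal_map (T p) = p" if "p \<in> W" for p
    using that the_inv_into_into[OF inj _ subset_refl] f_the_inv_into_f[OF inj]
    unfolding W_def T_def by blast+
  have T_eq: "T (normal_map q) = q" if "q \<in> S" for q
    unfolding T_def by (rule the_inv_into_f_f[OF inj that])
  define s where "s = (\<lambda>p. (fst (T p), ?P (fst (snd (T p)))))"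
  have lip: "K-lipschitz_on W s"
  proof (rule lipschitz_onI)
    fix p p' assume p: "p \<in> W" "p' \<in> W"
    obtain x z w x' z' w' where q: "T p = (x, z, w)" "T p' = (x', z', w')" by (metis prod_cases3)
    have "norm (x - x', ?P z - ?P z') \<le> norm (x - x', z - z')"
      unfolding norm_Pair by (intro real_sqrt_le_mono add_left_mono power_mono norm_proj_multiplier_diff_le) simp
    also have "\<dots> \<le> K * norm (p - p')"
      using S(5)[rule_format, of x z w x' z' w'] T[OF p(1)] T[OF p(2)] by (simp add: q)
    finally show "dist (s p) (s p') \<le> K * dist p p'" by (simp add: s_def q dist_norm)
  qed (use S(3) in simp)
  \<comment> \<open>\<Psi> lifts a parameter and a candidate \<open>(x, y)\<close> to the point at
    which the normal map would have to be evaluated. Its continuity ensures that no solution close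
    to \<open>(xbar, ybar)\<close> is lifted outside \<open>S\<close>.\<close>
  define \<Psi> where "\<Psi> = (\<lambda>q :: ('w \<times> (real^'n) \<times> (real^'m)) \<times> ((real^'n) \<times> (real^'m)).
      (fst (snd q), snd (snd q) + F (fst (snd q), fst (fst q)) - snd (snd (fst q)), fst (fst q)))"
  have "\<forall>\<^sub>F q in nhds ((wbar, 0, 0), (xbar, ybar)). \<Psi> q \<in> S"
  proof (rule topological_tendstoD[OF _ S(1,2)])
    let ?N = "nhds ((wbar, 0 :: real^'n, 0 :: real^'m), (xbar, ybar))"
    have id: "((\<lambda>q. q) \<longlongrightarrow> ((wbar, 0, 0), (xbar, ybar))) ?N" by (rule filterlim_ident)
    note f = tendsto_fst[OF id] and s = tendsto_snd[OF id]
    note lims = tendsto_fst[OF f] tendsto_snd[OF tendsto_snd[OF f]] tendsto_fst[OF s] tendsto_snd[OF s]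
    have w: "((\<lambda>q. fst (fst q)) \<longlongrightarrow> wbar) ?N" and u: "((\<lambda>q. snd (snd (fst q))) \<longlongrightarrow> 0) ?N"
      and x: "((\<lambda>q. fst (snd q)) \<longlongrightarrow> xbar) ?N" and y: "((\<lambda>q. snd (snd q)) \<longlongrightarrow> ybar) ?N"
      using lims by simp_all
    have "((\<lambda>q. F (fst (snd q), fst (fst q))) \<longlongrightarrow> F (xbar, wbar)) ?N"
      by (rule strict_derivative_tendsto[OF F_deriv tendsto_Pair[OF x w]])
    then have "((\<lambda>q. snd (snd q) + F (fst (snd q), fst (fst q)) - snd (snd (fst q))) \<longlongrightarrow> ybar + F (xbar, wbar) - 0) ?N"
      by (intro tendsto_diff tendsto_add y u)
    then show "(\<Psi> \<longlongrightarrow> (xbar, zbar, wbar)) ?N"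
      unfolding \<Psi>_def zbar_def by (intro tendsto_Pair x w) simp
  qed
  then obtain Q where Q: "open Q" "((wbar, 0, 0), (xbar, ybar)) \<in> Q" "\<forall>q\<in>Q. \<Psi> q \<in> S"
    unfolding eventually_nhds by blast
  obtain U0 V where UV: "open U0" "open V" "(wbar, 0, 0) \<in> U0" "(xbar, ybar) \<in> V" "U0 \<times> V \<subseteq> Q"
    using open_prod_elim[OF Q(1,2)] by (metis mem_Sigma_iff)
  \<comment> \<open>The preimage makes \<open>s\<close> take values in \<open>V\<close>; the factor
    \<open>U0\<close> makes every solution in \<open>V\<close> lift into \<open>S\<close>, where
    injectivity identifies it with \<open>s p\<close>.\<close>
  define U where "U = U0 \<inter> (W \<inter> s -` V)"
  have "open U" unfolding U_def
    by (intro open_Int UV(1) continuous_open_preimage[OF lipschitz_on_continuous_on[OF lip] \<open>open W\<close> UV(2)])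
  have bar: "(wbar, 0, 0) \<in> W" "s (wbar, 0, 0) = (xbar, ybar)"
  proof -
    show "(wbar, 0, 0) \<in> W" unfolding W_def using normal_map_bar S(2) by (metis imageI)
    show "s (wbar, 0, 0) = (xbar, ybar)"
      using T_eq[OF S(2)] by (simp add: normal_map_bar s_def proj_zbar)
  qed
  have graph: "s p = xy \<longleftrightarrow> xy \<in> solutions p \<and> xy \<in> V" if "p \<in> U" for p xy
  proof -
    obtain w v u where p: "p = (w, v, u)" by (rule prod_cases3)
    obtain x y where xy: "xy = (x, y)" by (rule prod.exhaust)
    have pW: "p \<in> W" and sV: "s p \<in> V" and pU: "p \<in> U0" using that by (auto simp: U_def)
    show ?thesis
    proof
      assume s: "s p = xy"
      obtain x' z' w' where q: "T p = (x', z', w')" by (rule prod_cases3)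
      have "(x', ?P z') \<in> solutions (w, v, u)"
        by (rule normal_map_imp_solution[of x' z' w']) (use T(2)[OF pW, unfolded q] p in simp)
      moreover have "s p = (x', ?P z')" by (simp only: s_def q fst_conv snd_conv)
      ultimately show "xy \<in> solutions p \<and> xy \<in> V" using s sV p by simp
    next
      assume sol: "xy \<in> solutions p \<and> xy \<in> V"
      then have "(p, xy) \<in> Q" using UV(5) pU by blast
      then have "(x, y + F (x, w) - u, w) \<in> S" using Q(3) by (fastforce simp: \<Psi>_def p xy)
      then have "T (normal_map (x, y + F (x, w) - u, w)) = (x, y + F (x, w) - u, w)" by (rule T_eq)
      then show "s p = xy"
        using solution_imp_normal_map[of x y w v u] sol by (simp add: s_def p xy)
    qed
  qed
  have "{(p, s p) | p. p \<in> U} = graph_of solutions \<inter> (U \<times> V)"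
  proof (rule set_eqI)
    fix r :: "('w \<times> (real^'n) \<times> (real^'m)) \<times> (real^'n) \<times> (real^'m)"
    obtain p xy where r: "r = (p, xy)" by (rule prod.exhaust)
    have "r \<in> {(p, s p) | p. p \<in> U} \<longleftrightarrow> p \<in> U \<and> s p = xy" unfolding r by blast
    also have "\<dots> \<longleftrightarrow> r \<in> graph_of solutions \<inter> (U \<times> V)"
      using graph[of p xy] by (simp add: graph_of_def r) metis
    finally show "r \<in> {(p, s p) | p. p \<in> U} \<longleftrightarrow> r \<in> graph_of solutions \<inter> (U \<times> V)" .
  qed
  moreover have "K-lipschitz_on U s" by (rule lipschitz_on_subset[OF lip]) (auto simp: U_def)
  moreover have "s ` U \<subseteq> V" by (auto simp: U_def)
  moreover have "(wbar, 0, 0) \<in> U" using bar UV by (simp add: U_def)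
  ultimately show ?thesis
    unfolding has_lipschitz_localization_def using \<open>open U\<close> UV(2,4) by blast
qed

text \<open>Moving the multipliers of \<open>A\<close> and the slacks of the indices outside \<open>A \<union> Z\<close> off zero
  turns \<open>(xbar, ybar)\<close> into a nearby solution whose weakly active set is \<open>Z\<close>. Along the
  solution path through it in the parameter direction \<open>(0, w1, - w2)\<close>, pairing with \<open>w1\<close>
  bounds the squared norm of \<open>(w1, w2)\<close> by the error of the linearization.\<close>

lemma localization_imp_critical:
  assumes loc: "has_lipschitz_localization solutions (wbar, 0, 0) (xbar, ybar)"
  shows "critical_condition strongly_active weakly_active G B C"
  unfolding critical_condition_def
proof (intro allI impI, elim conjE)
  fix A Z w1 and w :: "real^'m"
  assume A: "strongly_active \<subseteq> A" and AZ: "A \<union> Z \<subseteq> strongly_active \<union> weakly_active"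
    and AZ_disj: "A \<inter> Z = {}"
    and G: "transpose G *v w1 = (\<Sum>k\<in>A \<union> Z. w $ k *\<^sub>R row k C)"
    and BA: "\<forall>k\<in>A. column k B \<bullet> w1 = 0"
    and BZ: "\<forall>k\<in>Z. column k B \<bullet> w1 \<le> 0 \<and> 0 \<le> w $ k"
  \<comment> \<open>The criterion leaves the other entries of \<open>w\<close> arbitrary; they are
    cut off so that they do not enter the parameter direction.\<close>
  define w2 :: "real^'m" where "w2 = (\<chi> k. if k \<in> A \<union> Z then w $ k else 0)"
  have w2: "w2 $ k = w $ k" if "k \<in> A \<union> Z" for k using that by (simp add: w2_def)
  define N where "N = (norm w1)\<^sup>2 + (\<Sum>k\<in>A \<union> Z. (w $ k)\<^sup>2)"
  define R where "R = norm w1 + (\<Sum>k\<in>A \<union> Z. \<bar>w $ k\<bar>)"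
  define M where "M = norm (0 :: 'w, w1, - w2)"
  obtain U V s \<kappa> where U: "open U" "(wbar, 0, 0) \<in> U" and V: "open V" "(xbar, ybar) \<in> V"
    and lip: "\<kappa>-lipschitz_on U s" and graph: "{(p, s p) | p. p \<in> U} = graph_of solutions \<inter> (U \<times> V)"
    using loc unfolding has_lipschitz_localization_def by blast
  have sol_s: "s p \<in> solutions p" if "p \<in> U" for p
  proof -
    have "(p, s p) \<in> graph_of solutions \<inter> (U \<times> V)" unfolding graph[symmetric] using that by blast
    then show ?thesis by (simp add: graph_of_def)
  qed
  have s_eq: "s p = xy" if "p \<in> U" "xy \<in> V" "xy \<in> solutions p" for p xy
  proof -
    have "(p, xy) \<in> {(p, s p) | p. p \<in> U}" unfolding graph using that by (simp add: graph_of_def)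
    then show ?thesis by blast
  qed
  have \<kappa>: "\<kappa> \<ge> 0" using lip by (rule lipschitz_on_nonneg)
  have R: "R \<ge> 0" unfolding R_def by (intro add_nonneg_nonneg sum_nonneg) auto
  have M: "M \<ge> 0" unfolding M_def by (rule norm_ge_zero)
  have E_sub: "k \<in> A" "k \<notin> weakly_active" if "k \<in> E" for k
    using that A active_disjoint by (auto simp: strongly_active_def)
  have Z_sub: "k \<in> weakly_active" "k \<notin> A" "k \<notin> E" if "k \<in> Z" for k
    using that A AZ AZ_disj E_sub by blast+
  \<comment> \<open>\<eta> is the accuracy of the linearization. The base point and the step length
    below depend on it, but \<kappa>, \<open>M\<close> and \<open>R\<close> do not, so letting
    \<eta> tend to 0 yields \<open>N\<close> \<le> 0.\<close>
  have N_le: "N \<le> \<eta> * (\<kappa> * M * R)" if \<eta>: "\<eta> > 0" for \<eta>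
  proof -
    have Lw0: "Lw 0 = 0" and Fw0: "Fw 0 = 0"
      using linear_0[OF bounded_linear.linear[OF strict_derivative_bounded_linear[OF L_deriv]]]
        linear_0[OF bounded_linear.linear[OF strict_derivative_bounded_linear[OF F_deriv]]]
      by (simp_all add: zero_prod_def)
    obtain d1 where d1: "d1 > 0" "\<forall>p\<in>ball (xbar, ybar, wbar) d1. \<forall>p'\<in>ball (xbar, ybar, wbar) d1.
        norm (L p - L p' - (\<lambda>(dx, dy, dw). G *v dx + B *v dy + Lw dw) (p - p')) \<le> \<eta> * norm (p - p')"
      using strict_derivativeD[OF L_deriv \<eta>] by blast
    obtain d2 where d2: "d2 > 0" "\<forall>p\<in>ball (xbar, wbar) d2. \<forall>p'\<in>ball (xbar, wbar) d2.
        norm (F p - F p' - (\<lambda>(dx, dw). C *v dx + Fw dw) (p - p')) \<le> \<eta> * norm (p - p')"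
      using strict_derivativeD[OF F_deriv \<eta>] by blast
    \<comment> \<open>\<open>Y\<close> makes the multipliers of weakly active indices in
      \<open>A\<close> positive; \<open>W\<close> raises \<open>u\<close> at those outside
      \<open>A\<close> and \<open>Z\<close>, which makes their constraint values negative.\<close>
    define Y W :: "real^'m" where "Y = (\<chi> k. if k \<in> A \<inter> weakly_active then 1 else 0)"
      and "W = (\<chi> k. if k \<in> weakly_active - A - Z then 1 else 0)"
    \<comment> \<open>The value of \<open>v\<close> is chosen so that \<open>xbar\<close> stays
      stationary for the shifted multiplier.\<close>
    define p where "p = (\<lambda>\<epsilon>. (wbar, L (xbar, ybar + \<epsilon> *\<^sub>R Y, wbar), \<epsilon> *\<^sub>R W))"
    have "((\<lambda>\<epsilon>. ybar + \<epsilon> *\<^sub>R Y) \<longlongrightarrow> ybar + 0 *\<^sub>R Y) (at_right 0)" by (intro tendsto_intros)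
    then have y_lim: "((\<lambda>\<epsilon>. ybar + \<epsilon> *\<^sub>R Y) \<longlongrightarrow> ybar) (at_right 0)" by simp
    then have xyw_lim: "((\<lambda>\<epsilon>. (xbar, ybar + \<epsilon> *\<^sub>R Y, wbar)) \<longlongrightarrow> (xbar, ybar, wbar)) (at_right 0)"
      by (intro tendsto_intros)
    have "((\<lambda>\<epsilon>. \<epsilon> *\<^sub>R W) \<longlongrightarrow> 0 *\<^sub>R W) (at_right 0)" by (intro tendsto_intros)
    then have p_lim: "(p \<longlongrightarrow> (wbar, 0, 0)) (at_right 0)"
      unfolding p_def using strict_derivative_tendsto[OF L_deriv xyw_lim]
      by (intro tendsto_Pair) (simp_all add: stationary)
    have "\<forall>\<^sub>F \<epsilon> in at_right 0. 0 < \<epsilon> \<and> p \<epsilon> \<in> U \<and> (xbar, ybar + \<epsilon> *\<^sub>R Y) \<in> V \<and>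
        (xbar, ybar + \<epsilon> *\<^sub>R Y, wbar) \<in> ball (xbar, ybar, wbar) d1"
      by (intro eventually_conj eventually_at_right_less topological_tendstoD[OF p_lim U]
          topological_tendstoD[OF tendsto_Pair[OF tendsto_const y_lim] V]
          topological_tendstoD[OF xyw_lim]) (simp_all add: d1(1))
    then obtain \<epsilon> where \<epsilon>: "0 < \<epsilon>" "p \<epsilon> \<in> U" "(xbar, ybar + \<epsilon> *\<^sub>R Y) \<in> V"
        "(xbar, ybar + \<epsilon> *\<^sub>R Y, wbar) \<in> ball (xbar, ybar, wbar) d1"
      using eventually_happens'[OF trivial_limit_at_right_real] by blast
    define y0 u0 where "y0 = ybar + \<epsilon> *\<^sub>R Y" and "u0 = \<epsilon> *\<^sub>R W"
    have y0: "y0 $ k = (if k \<in> A \<inter> weakly_active then \<epsilon> else ybar $ k)" for k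
      by (simp add: y0_def Y_def weakly_active_def)
    have u0: "u0 $ k = (if k \<in> weakly_active - A - Z then \<epsilon> else 0)" for k
      by (simp add: u0_def W_def)
    have slack0: "F (xbar, wbar) $ k - u0 $ k = 0" if "k \<in> A \<union> Z" for k
      using that AZ active[of k] u0[of k] by auto
    have pos0: "k \<in> E \<or> 0 < y0 $ k" if "k \<in> A" for k
      using that AZ \<epsilon>(1) y0[of k] by (auto simp: strongly_active_def)
    have zero0: "y0 $ k = 0" if "k \<notin> A" for k
      using that A y0[of k] inactive(3)[of k] by (cases "k \<in> weakly_active") (auto simp: weakly_active_def)
    have neg0: "F (xbar, wbar) $ k - u0 $ k < 0" if "k \<notin> A \<union> Z" for k
      using that A u0[of k] inactive(2)[of k] \<epsilon>(1) by (cases "k \<in> weakly_active") (auto simp: weakly_active_def)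
    have "complementary E y0 (F (xbar, wbar) - u0)"
      unfolding complementary_def
    proof
      fix k
      show "if k \<in> E then (F (xbar, wbar) - u0) $ k = 0
        else 0 \<le> y0 $ k \<and> (F (xbar, wbar) - u0) $ k \<le> 0 \<and> y0 $ k * (F (xbar, wbar) - u0) $ k = 0"
        using slack0[of k] pos0[of k] zero0[of k] neg0[of k] E_sub(1)[of k]
        by (cases "k \<in> A"; cases "k \<in> Z") auto
    qed
    then have "(xbar, y0) \<in> solutions (p \<epsilon>)"
      by (simp add: solutions_def p_def y0_def u0_def)
    then have s0: "s (p \<epsilon>) = (xbar, y0)" using \<epsilon>(2,3) by (intro s_eq) (simp_all add: y0_def)
    define q where "q = (\<lambda>t. p \<epsilon> + t *\<^sub>R (0, w1, - w2))"
    have "(q \<longlongrightarrow> p \<epsilon> + 0 *\<^sub>R (0, w1, - w2)) (at_right 0)"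
      unfolding q_def by (intro tendsto_intros)
    then have q_lim: "(q \<longlongrightarrow> p \<epsilon>) (at_right 0)" by (simp only: scaleR_zero_left add_0_right)
    have "isCont s (p \<epsilon>)"
      using lipschitz_on_continuous_on[OF lip] U(1) \<epsilon>(2) by (simp add: continuous_on_eq_continuous_at)
    then have s_lim: "((\<lambda>t. s (q t)) \<longlongrightarrow> (xbar, y0)) (at_right 0)"
      using isCont_tendsto_compose[OF _ q_lim] s0 by metis
    have x_lim: "((\<lambda>t. (fst (s (q t)), wbar)) \<longlongrightarrow> (xbar, wbar)) (at_right 0)"
      using tendsto_fst[OF s_lim] by (intro tendsto_Pair) simp_all
    have y_lim: "((\<lambda>t. snd (s (q t))) \<longlongrightarrow> y0) (at_right 0)"
      using tendsto_snd[OF s_lim] by simp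
    have F_lim: "((\<lambda>t. F (fst (s (q t)), wbar) - (u0 - t *\<^sub>R w2)) \<longlongrightarrow> F (xbar, wbar) - (u0 - 0 *\<^sub>R w2)) (at_right 0)"
      by (intro tendsto_intros strict_derivative_tendsto[OF F_deriv x_lim])
    have near_L: "\<forall>\<^sub>F t in at_right 0. (fst (s (q t)), snd (s (q t)), wbar) \<in> ball (xbar, ybar, wbar) d1"
      using tendsto_fst[OF s_lim] y_lim \<epsilon>(4)
      by (intro topological_tendstoD[of _ "(xbar, y0, wbar)"] tendsto_Pair tendsto_const)
         (simp_all add: y0_def)
    have near_F: "\<forall>\<^sub>F t in at_right 0. (fst (s (q t)), wbar) \<in> ball (xbar, wbar) d2"
      by (rule topological_tendstoD[OF x_lim]) (simp_all add: d2(1))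
    have near_k: "\<forall>\<^sub>F t in at_right 0. \<forall>k. (0 < y0 $ k \<longrightarrow> 0 < snd (s (q t)) $ k) \<and>
        ((F (xbar, wbar) - u0) $ k < 0 \<longrightarrow> (F (fst (s (q t)), wbar) - (u0 - t *\<^sub>R w2)) $ k < 0)"
    proof (intro eventually_all_finite eventually_conj)
      fix k
      show "\<forall>\<^sub>F t in at_right 0. 0 < y0 $ k \<longrightarrow> 0 < snd (s (q t)) $ k"
        using order_tendstoD(1)[OF tendsto_vec_nth[OF y_lim, of k], of 0]
        by (cases "0 < y0 $ k") simp_all
      show "\<forall>\<^sub>F t in at_right 0. (F (xbar, wbar) - u0) $ k < 0 \<longrightarrow>
          (F (fst (s (q t)), wbar) - (u0 - t *\<^sub>R w2)) $ k < 0"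
        using order_tendstoD(2)[OF tendsto_vec_nth[OF F_lim, of k], of 0]
        by (cases "(F (xbar, wbar) - u0) $ k < 0") simp_all
    qed
    obtain t where t: "0 < t" "q t \<in> U"
      "(fst (s (q t)), snd (s (q t)), wbar) \<in> ball (xbar, ybar, wbar) d1"
      "(fst (s (q t)), wbar) \<in> ball (xbar, wbar) d2"
      "\<forall>k. (0 < y0 $ k \<longrightarrow> 0 < snd (s (q t)) $ k) \<and>
        ((F (xbar, wbar) - u0) $ k < 0 \<longrightarrow> (F (fst (s (q t)), wbar) - (u0 - t *\<^sub>R w2)) $ k < 0)"
      using eventually_happens'[OF trivial_limit_at_right_real
          eventually_conj[OF eventually_at_right_less eventually_conj[OF
              topological_tendstoD[OF q_lim U(1) \<epsilon>(2)] eventually_conj[OF near_L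
              eventually_conj[OF near_F near_k]]]]] by blast
    define x y where "x = fst (s (q t))" and "y = snd (s (q t))"
    define dx dy dF where "dx = x - xbar" and "dy = y - y0" and "dF = F (x, wbar) - F (xbar, wbar)"
    have qt: "q t = (wbar, L (xbar, y0, wbar) + t *\<^sub>R w1, u0 - t *\<^sub>R w2)"
      by (simp add: q_def p_def y0_def u0_def)
    have "(x, y) \<in> solutions (q t)" using sol_s[OF t(2)] by (simp add: x_def y_def)
    then have Lt: "L (x, y, wbar) = L (xbar, y0, wbar) + t *\<^sub>R w1"
      and Ft: "complementary E y (F (x, wbar) - (u0 - t *\<^sub>R w2))"
      by (simp_all add: solutions_def qt)
    have slack: "(F (x, wbar) - (u0 - t *\<^sub>R w2)) $ k = F (x, wbar) $ k - u0 $ k + t * w2 $ k" for k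
      by simp
    have Ftk: "if k \<in> E then F (x, wbar) $ k - u0 $ k + t * w2 $ k = 0
      else 0 \<le> y $ k \<and> F (x, wbar) $ k - u0 $ k + t * w2 $ k \<le> 0 \<and>
        y $ k * (F (x, wbar) $ k - u0 $ k + t * w2 $ k) = 0" for k
      using Ft[unfolded complementary_def slack, rule_format, of k] .
    have near: "0 < y0 $ k \<longrightarrow> 0 < y $ k"
      "F (xbar, wbar) $ k - u0 $ k < 0 \<longrightarrow> F (x, wbar) $ k - u0 $ k + t * w2 $ k < 0" for k
      using t(5)[rule_format, of k] by (simp_all add: x_def y_def algebra_simps)
    \<comment> \<open>A multiplier that starts positive is still positive for small
      \<open>t\<close>, so complementarity keeps the shifted constraint value at zero; for an
      equality it is zero anyway.\<close>
    have dF_A: "dF $ k = - (t * w $ k)" if "k \<in> A" for k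
      using that pos0[OF that] slack0[of k] near(1)[of k] Ftk[of k] w2[of k]
      by (cases "k \<in> E") (simp_all add: dF_def)
    \<comment> \<open>At these indices both quantities start at zero, and only the sign conditions
      of the new solution are known.\<close>
    have dF_Z: "dF $ k \<le> - (t * w $ k)" and dy_Z: "0 \<le> dy $ k" if "k \<in> Z" for k
      using Z_sub[OF that] that zero0[of k] slack0[of k] Ftk[of k] w2[of k]
      by (simp_all add: dF_def dy_def)
    \<comment> \<open>A constraint value that starts negative stays negative, hence its multiplier
      remains zero.\<close>
    have dy_0: "dy $ k = 0" if "k \<notin> A \<union> Z" for k
      using that E_sub(1)[of k] zero0[of k] neg0[of k] near(2)[of k] Ftk[of k]
      by (auto simp: dy_def split: if_splits)
    define \<rho> where "\<rho> = \<kappa> * (t * M)"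
    have "s (q t) = (x, y)" by (simp add: x_def y_def)
    then have "norm (dx, dy) = dist (s (q t)) (s (p \<epsilon>))"
      by (simp add: s0 dist_norm dx_def dy_def)
    also have "\<dots> \<le> \<kappa> * dist (q t) (p \<epsilon>)" by (rule lipschitz_onD[OF lip t(2) \<epsilon>(2)])
    also have "dist (q t) (p \<epsilon>) = t * M"
      using t(1) unfolding q_def dist_norm M_def add_diff_cancel_left' norm_scaleR by simp
    finally have \<rho>: "norm (dx, dy) \<le> \<rho>" by (simp add: \<rho>_def)
    have "norm (t *\<^sub>R w1 - (G *v dx + B *v dy)) \<le> \<eta> * norm (dx, dy, 0 :: 'w)"
      using d1(2)[rule_format, OF t(3) \<epsilon>(4)]
      by (simp add: Lw0 dx_def dy_def x_def[symmetric] y_def[symmetric] y0_def[symmetric] Lt)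
    also have "norm (dx, dy, 0 :: 'w) = norm (dx, dy)" by (simp add: norm_Pair)
    also have "\<eta> * norm (dx, dy) \<le> \<eta> * \<rho>" using \<rho> \<eta> by simp
    finally have eL: "norm (t *\<^sub>R w1 - (G *v dx + B *v dy)) \<le> \<eta> * \<rho>" .
    have "norm (dF - C *v dx) \<le> \<eta> * norm (dx, 0 :: 'w)"
      using d2(2)[rule_format, OF t(4), of "(xbar, wbar)"] d2(1)
      by (simp add: Fw0 dx_def dF_def x_def[symmetric])
    also have "\<dots> \<le> \<eta> * \<rho>"
      using order_trans[OF norm_fst_le \<rho>] \<eta> by (simp add: norm_Pair)
    finally have eF: "norm (dF - C *v dx) \<le> \<eta> * \<rho>" .
    have eFk: "w $ k * (C *v dx) $ k \<le> - (t * (w $ k)\<^sup>2) + \<bar>w $ k\<bar> * (\<eta> * \<rho>)" if "k \<in> A \<union> Z" for k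
    proof -
      have "\<bar>(dF - C *v dx) $ k\<bar> \<le> \<eta> * \<rho>" using eF component_le_norm_cart order_trans by blast
      then have "\<bar>w $ k\<bar> * \<bar>(C *v dx) $ k - dF $ k\<bar> \<le> \<bar>w $ k\<bar> * (\<eta> * \<rho>)"
        by (intro mult_left_mono) (auto simp: abs_minus_commute)
      then have "w $ k * ((C *v dx) $ k - dF $ k) \<le> \<bar>w $ k\<bar> * (\<eta> * \<rho>)"
        unfolding abs_mult[symmetric] by linarith
      moreover have "w $ k * dF $ k \<le> w $ k * (- (t * w $ k))"
      proof (cases "k \<in> A")
        case False
        then show ?thesis using that BZ dF_Z[of k] by (intro mult_left_mono) auto
      qed (simp add: dF_A)
      ultimately show ?thesis by (simp add: algebra_simps power2_eq_square)
    qed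
    \<comment> \<open>The criterion is tailored to this sign: on \<open>A\<close> the columns are
      orthogonal to \<open>w1\<close>, on \<open>Z\<close> a nonnegative \<open>dy\<close> meets a
      nonpositive product, and elsewhere \<open>dy\<close> vanishes.\<close>
    have "w1 \<bullet> (B *v dy) = (\<Sum>k\<in>UNIV. dy $ k * (column k B \<bullet> w1))"
      by (simp add: matrix_mult_sum inner_sum_right scalar_mult_eq_scaleR inner_commute)
    also have "\<dots> \<le> 0"
    proof (rule sum_nonpos)
      fix k
      show "dy $ k * (column k B \<bullet> w1) \<le> 0"
        using dy_0[of k] BA BZ dy_Z[of k]
        by (cases "k \<in> A"; cases "k \<in> Z") (auto simp: mult_nonneg_nonpos)
    qed
    finally have B_le: "w1 \<bullet> (B *v dy) \<le> 0" .
    \<comment> \<open>The equation for \<open>transpose G *v w1\<close> turns this product into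
      changes of constraint values, which the direction \<open>- w2\<close> in \<open>u\<close> has
      forced to be at most -\<open>t * w $ k\<close> up to the error, after weighting by
      \<open>w $ k\<close>.\<close>
    have "w1 \<bullet> (G *v dx) = (transpose G *v w1) \<bullet> dx"
      by (simp add: dot_lmul_matrix)
    also have "\<dots> = (\<Sum>k\<in>A \<union> Z. w $ k * (C *v dx) $ k)"
      unfolding G by (simp add: inner_sum_left row_def matrix_vector_mul_component)
    also have "\<dots> \<le> (\<Sum>k\<in>A \<union> Z. - (t * (w $ k)\<^sup>2) + \<bar>w $ k\<bar> * (\<eta> * \<rho>))"
      by (rule sum_mono) (rule eFk)
    also have "\<dots> = - (t * (\<Sum>k\<in>A \<union> Z. (w $ k)\<^sup>2)) + (\<Sum>k\<in>A \<union> Z. \<bar>w $ k\<bar>) * (\<eta> * \<rho>)"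
      by (simp add: sum.distrib sum_subtractf sum_negf sum_distrib_left sum_distrib_right)
    finally have G_le: "w1 \<bullet> (G *v dx) \<le>
      - (t * (\<Sum>k\<in>A \<union> Z. (w $ k)\<^sup>2)) + (\<Sum>k\<in>A \<union> Z. \<bar>w $ k\<bar>) * (\<eta> * \<rho>)" .
    have "w1 \<bullet> (t *\<^sub>R w1 - (G *v dx + B *v dy)) \<le> norm w1 * (\<eta> * \<rho>)"
      by (rule order_trans[OF norm_cauchy_schwarz mult_left_mono[OF eL]]) simp
    then have "t * (norm w1)\<^sup>2 - w1 \<bullet> (G *v dx) - w1 \<bullet> (B *v dy) \<le> norm w1 * (\<eta> * \<rho>)"
      by (simp add: inner_diff_right inner_add_right power2_norm_eq_inner algebra_simps)
    with G_le B_le have "t * N \<le> R * (\<eta> * \<rho>)"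
      by (simp add: N_def R_def algebra_simps)
    \<comment> \<open>The Lipschitz property makes the distance \<rho> proportional to
      \<open>t\<close>, so that \<open>t\<close> cancels.\<close>
    then have "t * N \<le> t * (\<eta> * (\<kappa> * M * R))" by (simp add: \<rho>_def algebra_simps)
    then show ?thesis using t(1) by simp
  qed
  have "N \<le> 0"
    using \<kappa> M R by (intro nonpos_if_le_arbitrary_multiple[of N "\<kappa> * M * R"] N_le mult_nonneg_nonneg)
  moreover have sum: "0 \<le> (\<Sum>k\<in>A \<union> Z. (w $ k)\<^sup>2)" by (intro sum_nonneg) simp
  ultimately have "(norm w1)\<^sup>2 = 0" "(\<Sum>k\<in>A \<union> Z. (w $ k)\<^sup>2) = 0"
    using zero_le_power2[of "norm w1"] unfolding N_def by linarith+
  then show "w1 = 0 \<and> (\<forall>k\<in>A \<union> Z. w $ k = 0)"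
    by (simp add: sum_nonneg_eq_0_iff)
qed

end

section \<open>The game\<close>

lemma sum_fibres:
  fixes con :: "'m::finite \<Rightarrow> 'p::finite"
  assumes "\<And>\<nu>. S \<nu> \<subseteq> {k. con k = \<nu>}"
  shows "(\<Sum>\<nu>\<in>UNIV. \<Sum>k\<in>S \<nu>. h \<nu> k) = (\<Sum>k\<in>(\<Union>\<nu>. S \<nu>). h (con k) k)"
proof -
  have "(\<Sum>\<nu>\<in>UNIV. \<Sum>k\<in>S \<nu>. h \<nu> k) = (\<Sum>\<nu>\<in>UNIV. \<Sum>k\<in>S \<nu>. h (con k) k)"
    using assms by (intro sum.cong) auto
  also have "\<dots> = (\<Sum>k\<in>(\<Union>\<nu>. S \<nu>). h (con k) k)"
    using assms by (intro sum.UNION_disjoint[symmetric]) auto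
  finally show ?thesis .
qed

text \<open>The fibres of \<open>con\<close> are disjoint, so choosing a partition for every player
  amounts to choosing one pair \<open>A\<close>, \<open>Z\<close>, and the double sum over players
  and indices becomes a single sum.\<close>

lemma critical_condition_iff_blocks:
  fixes own :: "'n::finite \<Rightarrow> 'p::finite" and con :: "'m::finite \<Rightarrow> 'p"
    and G :: "real^'n^'n" and B :: "real^'m^'n" and C :: "real^'n^'m"
    and Jg :: "'p \<Rightarrow> real^'n^'m"
  assumes row: "\<And>k. row k C = row k (Jg (con k))"
    and column: "\<And>k w. column k B \<bullet> w = (Jg (con k) *v block own (con k) w) $ k"
    and \<alpha>: "\<And>\<nu>. \<alpha> \<nu> = {k \<in> \<alpha>'. con k = \<nu>}" and \<beta>: "\<And>\<nu>. \<beta> \<nu> = {k \<in> \<beta>'. con k = \<nu>}"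
    and disj: "\<alpha>' \<inter> \<beta>' = {}"
  shows "critical_condition \<alpha>' \<beta>' G B C \<longleftrightarrow>
    (\<forall>\<beta>p \<beta>z \<beta>m \<alpha>p :: 'p \<Rightarrow> 'm set.
       (\<forall>\<nu>. \<beta> \<nu> = \<beta>p \<nu> \<union> \<beta>z \<nu> \<union> \<beta>m \<nu> \<and>
            \<beta>p \<nu> \<inter> \<beta>z \<nu> = {} \<and> \<beta>p \<nu> \<inter> \<beta>m \<nu> = {} \<and> \<beta>z \<nu> \<inter> \<beta>m \<nu> = {} \<and>
            \<alpha>p \<nu> = \<alpha> \<nu> \<union> \<beta>p \<nu>) \<longrightarrow>
       (\<forall>(w1 :: real^'n) (w2 :: real^'m).
          transpose G *v w1 =
            (\<Sum>\<nu>\<in>UNIV. (\<Sum>i\<in>\<alpha>p \<nu>. w2 $ i *\<^sub>R row i (Jg \<nu>)) + (\<Sum>i\<in>\<beta>z \<nu>. w2 $ i *\<^sub>R row i (Jg \<nu>))) \<and>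
          (\<forall>\<nu>. (\<forall>i\<in>\<alpha>p \<nu>. (Jg \<nu> *v block own \<nu> w1) $ i = 0) \<and>
               (\<forall>i\<in>\<beta>z \<nu>. (Jg \<nu> *v block own \<nu> w1) $ i \<le> 0) \<and>
               (\<forall>i\<in>\<beta>z \<nu>. 0 \<le> w2 $ i)) \<longrightarrow>
          w1 = 0 \<and> (\<forall>\<nu>. \<forall>i\<in>\<alpha>p \<nu> \<union> \<beta>z \<nu>. w2 $ i = 0)))"
    (is "_ \<longleftrightarrow> ?blocks")
proof
  have sums: "(\<Sum>\<nu>\<in>UNIV. (\<Sum>i\<in>S \<nu>. w $ i *\<^sub>R row i (Jg \<nu>)) + (\<Sum>i\<in>T \<nu>. w $ i *\<^sub>R row i (Jg \<nu>)))
      = (\<Sum>k\<in>(\<Union>\<nu>. S \<nu>) \<union> (\<Union>\<nu>. T \<nu>). w $ k *\<^sub>R row k C)"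
    if "\<And>\<nu>. S \<nu> \<subseteq> {k. con k = \<nu>}" "\<And>\<nu>. T \<nu> \<subseteq> {k. con k = \<nu>}" "(\<Union>\<nu>. S \<nu>) \<inter> (\<Union>\<nu>. T \<nu>) = {}"
    for S T :: "'p \<Rightarrow> 'm set" and w :: "real^'m"
    unfolding sum.distrib sum_fibres[OF that(1)] sum_fibres[OF that(2)] row
    by (rule sum.union_disjoint[symmetric]) (use that(3) in auto)
  {
    assume crit: "critical_condition \<alpha>' \<beta>' G B C"
    show ?blocks
    proof (intro allI impI, elim conjE)
      fix \<beta>p \<beta>z \<beta>m \<alpha>p :: "'p \<Rightarrow> 'm set" and w1 :: "real^'n" and w2 :: "real^'m"
      assume part: "\<forall>\<nu>. \<beta> \<nu> = \<beta>p \<nu> \<union> \<beta>z \<nu> \<union> \<beta>m \<nu> \<and>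
            \<beta>p \<nu> \<inter> \<beta>z \<nu> = {} \<and> \<beta>p \<nu> \<inter> \<beta>m \<nu> = {} \<and> \<beta>z \<nu> \<inter> \<beta>m \<nu> = {} \<and>
            \<alpha>p \<nu> = \<alpha> \<nu> \<union> \<beta>p \<nu>"
        and eq: "transpose G *v w1 =
            (\<Sum>\<nu>\<in>UNIV. (\<Sum>i\<in>\<alpha>p \<nu>. w2 $ i *\<^sub>R row i (Jg \<nu>)) + (\<Sum>i\<in>\<beta>z \<nu>. w2 $ i *\<^sub>R row i (Jg \<nu>)))"
        and sgn: "\<forall>\<nu>. (\<forall>i\<in>\<alpha>p \<nu>. (Jg \<nu> *v block own \<nu> w1) $ i = 0) \<and>
               (\<forall>i\<in>\<beta>z \<nu>. (Jg \<nu> *v block own \<nu> w1) $ i \<le> 0) \<and> (\<forall>i\<in>\<beta>z \<nu>. 0 \<le> w2 $ i)"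
      define A Z where "A = (\<Union>\<nu>. \<alpha>p \<nu>)" and "Z = (\<Union>\<nu>. \<beta>z \<nu>)"
      have sub: "\<alpha>p \<nu> \<subseteq> {k. con k = \<nu>}" "\<beta>z \<nu> \<subseteq> {k. con k = \<nu>}"
        "\<alpha>p \<nu> \<subseteq> \<alpha>' \<union> \<beta>'" "\<beta>z \<nu> \<subseteq> \<beta>'" for \<nu>
        using part[rule_format, of \<nu>] \<alpha>[of \<nu>] \<beta>[of \<nu>] by auto
      have AZ_disj: "A \<inter> Z = {}"
      proof -
        have "\<alpha>p \<nu> \<inter> \<beta>z \<nu> = {}" for \<nu>
          using part[rule_format, of \<nu>] \<alpha>[of \<nu>] \<beta>[of \<nu>] disj by blast
        moreover have "\<nu> = \<nu>'" if "k \<in> \<alpha>p \<nu>" "k \<in> \<beta>z \<nu>'" for k \<nu> \<nu>'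
          using that sub(1)[of \<nu>] sub(2)[of \<nu>'] by auto
        ultimately show ?thesis unfolding A_def Z_def by blast
      qed
      have mem: "k \<in> \<alpha>p (con k)" if "k \<in> A" for k using that sub(1) by (auto simp: A_def)
      have mem': "k \<in> \<beta>z (con k)" if "k \<in> Z" for k using that sub(2) by (auto simp: Z_def)
      have "w1 = 0 \<and> (\<forall>k\<in>A \<union> Z. w2 $ k = 0)"
      proof (rule critical_conditionD[OF crit])
        show "\<alpha>' \<subseteq> A" unfolding A_def using part \<alpha> by auto
        show "A \<union> Z \<subseteq> \<alpha>' \<union> \<beta>'" unfolding A_def Z_def using sub by blast
        show "transpose G *v w1 = (\<Sum>k\<in>A \<union> Z. w2 $ k *\<^sub>R row k C)"
          unfolding eq A_def Z_def by (rule sums[OF sub(1,2) AZ_disj[unfolded A_def Z_def]])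
        show "A \<inter> Z = {}" by (rule AZ_disj)
        show "column k B \<bullet> w1 = 0" if "k \<in> A" for k using sgn mem[OF that] column by simp
        show "column k B \<bullet> w1 \<le> 0" if "k \<in> Z" for k using sgn mem'[OF that] column by simp
        show "0 \<le> w2 $ k" if "k \<in> Z" for k using sgn mem'[OF that] by blast
      qed
      then show "w1 = 0 \<and> (\<forall>\<nu>. \<forall>i\<in>\<alpha>p \<nu> \<union> \<beta>z \<nu>. w2 $ i = 0)"
        unfolding A_def Z_def by blast
    qed
  next
    assume blocks: ?blocks
    show "critical_condition \<alpha>' \<beta>' G B C"
      unfolding critical_condition_def
    proof (intro allI impI, elim conjE)
      fix A Z w1 and w2 :: "real^'m"
      assume A: "\<alpha>' \<subseteq> A" and AZ: "A \<union> Z \<subseteq> \<alpha>' \<union> \<beta>'" and AZ_disj: "A \<inter> Z = {}"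
        and eq: "transpose G *v w1 = (\<Sum>k\<in>A \<union> Z. w2 $ k *\<^sub>R row k C)"
        and sgn: "\<forall>k\<in>A. column k B \<bullet> w1 = 0" "\<forall>k\<in>Z. column k B \<bullet> w1 \<le> 0 \<and> 0 \<le> w2 $ k"
      \<comment> \<open>Each player's partition is recovered from \<open>A\<close> and
        \<open>Z\<close> by restriction to the fibre, the leftover of \<beta> forming the third
        part.\<close>
      define \<alpha>p \<beta>z \<beta>p \<beta>m where "\<alpha>p = (\<lambda>\<nu>. {k \<in> A. con k = \<nu>})" and "\<beta>z = (\<lambda>\<nu>. {k \<in> Z. con k = \<nu>})"
        and "\<beta>p = (\<lambda>\<nu>. {k \<in> A - \<alpha>'. con k = \<nu>})" and "\<beta>m = (\<lambda>\<nu>. {k \<in> \<beta>' - A - Z. con k = \<nu>})"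
      note defs = \<alpha>p_def \<beta>z_def \<beta>p_def \<beta>m_def
      have un: "(\<Union>\<nu>. \<alpha>p \<nu>) = A" "(\<Union>\<nu>. \<beta>z \<nu>) = Z" by (auto simp: defs)
      have part: "\<forall>\<nu>. \<beta> \<nu> = \<beta>p \<nu> \<union> \<beta>z \<nu> \<union> \<beta>m \<nu> \<and>
            \<beta>p \<nu> \<inter> \<beta>z \<nu> = {} \<and> \<beta>p \<nu> \<inter> \<beta>m \<nu> = {} \<and> \<beta>z \<nu> \<inter> \<beta>m \<nu> = {} \<and>
            \<alpha>p \<nu> = \<alpha> \<nu> \<union> \<beta>p \<nu>"
        unfolding defs \<alpha> \<beta> using A AZ AZ_disj disj by blast
      have "transpose G *v w1 =
          (\<Sum>\<nu>\<in>UNIV. (\<Sum>i\<in>\<alpha>p \<nu>. w2 $ i *\<^sub>R row i (Jg \<nu>)) + (\<Sum>i\<in>\<beta>z \<nu>. w2 $ i *\<^sub>R row i (Jg \<nu>)))"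
        by (subst sums) (simp_all only: un eq AZ_disj, auto simp: defs)
      moreover have "\<forall>\<nu>. (\<forall>i\<in>\<alpha>p \<nu>. (Jg \<nu> *v block own \<nu> w1) $ i = 0) \<and>
               (\<forall>i\<in>\<beta>z \<nu>. (Jg \<nu> *v block own \<nu> w1) $ i \<le> 0) \<and> (\<forall>i\<in>\<beta>z \<nu>. 0 \<le> w2 $ i)"
        using sgn by (auto simp: defs column)
      ultimately have "w1 = 0 \<and> (\<forall>\<nu>. \<forall>i\<in>\<alpha>p \<nu> \<union> \<beta>z \<nu>. w2 $ i = 0)"
        using blocks[rule_format, OF part[rule_format]] by blast
      then show "w1 = 0 \<and> (\<forall>k\<in>A \<union> Z. w2 $ k = 0)"
        unfolding un(1)[symmetric] un(2)[symmetric] by blast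
    qed
  }
qed

section \<open>Polar and normal cones of the constraint blocks\<close>

lemma K_polar_iff:
  "y \<in> K_polar con E \<nu> \<longleftrightarrow> y \<in> block_space con \<nu> \<and> (\<forall>k. con k = \<nu> \<and> k \<notin> E \<longrightarrow> 0 \<le> y $ k)"
proof
  assume y: "y \<in> K_polar con E \<nu>"
  have "0 \<le> y $ k" if k: "con k = \<nu>" "k \<notin> E" for k
  proof -
    \<comment> \<open>A negative unit vector tests one inequality index at a time.\<close>
    have "- axis k 1 \<in> K_cone con E \<nu>"
      using k by (auto simp: K_cone_def block_space_def axis_def)
    then have "y \<bullet> (- axis k 1) \<le> 0" using y unfolding K_polar_def polar_cone_in_def by blast
    then show ?thesis by (simp add: inner_axis)
  qed
  then show "y \<in> block_space con \<nu> \<and> (\<forall>k. con k = \<nu> \<and> k \<notin> E \<longrightarrow> 0 \<le> y $ k)"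
    using y by (simp add: K_polar_def polar_cone_in_def)
next
  assume y: "y \<in> block_space con \<nu> \<and> (\<forall>k. con k = \<nu> \<and> k \<notin> E \<longrightarrow> 0 \<le> y $ k)"
  have "y \<bullet> z \<le> 0" if z: "z \<in> K_cone con E \<nu>" for z
    unfolding inner_vec_def
  proof (rule sum_nonpos)
    fix k
    show "y $ k \<bullet> z $ k \<le> 0"
    proof (cases "con k = \<nu> \<and> k \<notin> E")
      case True
      then show ?thesis using y z by (auto simp: K_cone_def mult_nonneg_nonpos)
    next
      case False
      then show ?thesis using y z by (cases "con k = \<nu>") (auto simp: K_cone_def block_space_def)
    qed
  qed
  then show "y \<in> K_polar con E \<nu>" using y by (simp add: K_polar_def polar_cone_in_def)
qed

lemma normal_cone_K_polar_iff:
  assumes z: "z \<in> block_space con \<nu>"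
  shows "z \<in> normal_cone_in (block_space con \<nu>) (K_polar con E \<nu>) (block con \<nu> y) \<longleftrightarrow>
    (\<forall>k. con k = \<nu> \<longrightarrow> (if k \<in> E then z $ k = 0 else 0 \<le> y $ k \<and> z $ k \<le> 0 \<and> y $ k * z $ k = 0))"
    (is "?L \<longleftrightarrow> ?R")
proof
  assume L: ?L
  have y: "block con \<nu> y \<in> K_polar con E \<nu>" using L by (simp add: normal_cone_in_def)
  \<comment> \<open>Shifting one coordinate of the base point by \<open>a\<close> stays in the polar
    cone. The shifts 1 and -1 settle equality indices; for inequality indices 1 gives the sign of
    \<open>z $ k\<close>, and \<open>- (y $ k)\<close> gives orthogonality.\<close>
  have test: "z $ k * a \<le> 0" if "con k = \<nu>" "k \<in> E \<or> 0 \<le> y $ k + a" for k a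
  proof -
    have "block con \<nu> y + a *\<^sub>R axis k 1 \<in> K_polar con E \<nu>"
      using y that by (auto simp: K_polar_iff block_space_def block_def axis_def)
    then have "z \<bullet> (a *\<^sub>R axis k 1) \<le> 0" using L by (fastforce simp: normal_cone_in_def)
    then show ?thesis by (simp add: inner_axis mult.commute)
  qed
  show ?R
  proof (intro allI impI)
    fix k assume k: "con k = \<nu>"
    show "if k \<in> E then z $ k = 0 else 0 \<le> y $ k \<and> z $ k \<le> 0 \<and> y $ k * z $ k = 0"
    proof (cases "k \<in> E")
      case True
      then show ?thesis using test[OF k, of 1] test[OF k, of "-1"] by simp
    next
      case False
      then have "0 \<le> y $ k" using y k by (auto simp: K_polar_iff block_def)
      moreover from this have "z $ k \<le> 0" using test[OF k, of 1] by simp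
      moreover have "z $ k * (- (y $ k)) \<le> 0" by (rule test[OF k]) simp
      ultimately show ?thesis
        using False mult_nonneg_nonpos[of "y $ k" "z $ k"] by (simp add: mult.commute)
    qed
  qed
next
  assume R: ?R
  have "block con \<nu> y \<in> K_polar con E \<nu>"
    using R by (auto simp: K_polar_iff block_space_def block_def)
  moreover have "z \<bullet> (c - block con \<nu> y) \<le> 0" if c: "c \<in> K_polar con E \<nu>" for c
    unfolding inner_vec_def
  proof (rule sum_nonpos)
    fix k
    show "z $ k \<bullet> (c - block con \<nu> y) $ k \<le> 0"
    proof (cases "con k = \<nu>")
      case True
      have "z $ k * c $ k \<le> 0 \<and> z $ k * y $ k = 0"
      proof (cases "k \<in> E")
        case False
        moreover have "0 \<le> c $ k" using c True False by (simp add: K_polar_iff)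
        moreover have "0 \<le> y $ k \<and> z $ k \<le> 0 \<and> y $ k * z $ k = 0"
          using R True False by metis
        ultimately show ?thesis by (simp add: mult_nonpos_nonneg mult.commute[of "z $ k" "y $ k"])
      qed (use R True in \<open>metis mult_zero_left order_refl\<close>)
      then show ?thesis using True by (auto simp: block_def right_diff_distrib)
    next
      case False
      then show ?thesis using z by (simp add: block_space_def)
    qed
  qed
  ultimately show ?L using z by (simp add: normal_cone_in_def)
qed

text \<open>The Lagrangian gradient of one player in all variables. It is kept whole because the
  smoothness hypotheses and the rows of \<open>G_matrix\<close> refer to full gradients; the own
  components are selected afterwards.\<close>

definition player_map ::
  "('m::finite \<Rightarrow> 'p) \<Rightarrow> ('p \<Rightarrow> (real^'n) \<times> (real^'d) \<Rightarrow> real) \<Rightarrow>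
   ((real^'n) \<times> (real^'d) \<Rightarrow> real^'m) \<Rightarrow> 'p \<Rightarrow> (real^'n) \<times> (real^'m) \<times> (real^'d) \<Rightarrow> real^'n" where
  "player_map con f F \<nu> = (\<lambda>(x, y, w). gradient (\<lambda>z. f \<nu> (z, w)) x
     + transpose (jacobian (\<lambda>z. player_F con F \<nu> (z, w)) (at x)) *v block con \<nu> y)"

text \<open>Every variable and every constraint belongs to exactly one player, so the conditions of
  all players merge into one system of coordinates.\<close>

lemma S_Lag_iff:
  "(x, y) \<in> S_Lag own con E f F (w, v, u) \<longleftrightarrow>
    (\<chi> i. player_map con f F (own i) (x, y, w) $ i) = v \<and> complementary E y (F (x, w) - u)"
proof -
  have stationarity: "block own \<nu> (gradient (\<lambda>z. f \<nu> (z, w)) x)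
        + block own \<nu> (transpose (jacobian (\<lambda>z. player_F con F \<nu> (z, w)) (at x)) *v block con \<nu> y)
        - block own \<nu> v = 0 \<longleftrightarrow>
      (\<forall>i. own i = \<nu> \<longrightarrow> player_map con f F \<nu> (x, y, w) $ i = v $ i)" for \<nu>
    by (auto simp: vec_eq_iff block_def player_map_def)
  have complementarity: "0 \<in> (\<lambda>z. - player_F con F \<nu> (x, w) + block con \<nu> u + z) `
            normal_cone_in (block_space con \<nu>) (K_polar con E \<nu>) (block con \<nu> y) \<longleftrightarrow>
      (\<forall>k. con k = \<nu> \<longrightarrow> (if k \<in> E then (F (x, w) - u) $ k = 0
        else 0 \<le> y $ k \<and> (F (x, w) - u) $ k \<le> 0 \<and> y $ k * (F (x, w) - u) $ k = 0))" for \<nu>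
  proof -
    have "0 = - player_F con F \<nu> (x, w) + block con \<nu> u + z \<longleftrightarrow> z = block con \<nu> (F (x, w) - u)" for z
      by (auto simp: vec_eq_iff player_F_def block_def algebra_simps)
    then have "0 \<in> (\<lambda>z. - player_F con F \<nu> (x, w) + block con \<nu> u + z) `
            normal_cone_in (block_space con \<nu>) (K_polar con E \<nu>) (block con \<nu> y) \<longleftrightarrow>
      block con \<nu> (F (x, w) - u) \<in> normal_cone_in (block_space con \<nu>) (K_polar con E \<nu>) (block con \<nu> y)"
      unfolding image_iff by (simp only:) blast
    also have "\<dots> \<longleftrightarrow> (\<forall>k. con k = \<nu> \<longrightarrow> (if k \<in> E then (F (x, w) - u) $ k = 0
        else 0 \<le> y $ k \<and> (F (x, w) - u) $ k \<le> 0 \<and> y $ k * (F (x, w) - u) $ k = 0))"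
      by (subst normal_cone_K_polar_iff) (auto simp: block_space_def block_def)
    finally show ?thesis .
  qed
  show ?thesis
    unfolding S_Lag_def complementary_def prod.case mem_Collect_eq stationarity complementarity
    by (auto simp: vec_eq_iff)
qed

section \<open>Gradients, Jacobians and the Lagrangian\<close>

lemma gradient_eqI:
  fixes h :: "'a::real_inner \<Rightarrow> real"
  assumes "GDERIV h x :> D"
  shows "gradient h x = D"
  unfolding gradient_def
proof (rule the_equality)
  show "GDERIV h x :> D" by (rule assms)
  fix D' assume "GDERIV h x :> D'"
  then have "(\<lambda>y. y \<bullet> D') = (\<lambda>y. y \<bullet> D)"
    using assms unfolding gderiv_def by (rule has_derivative_unique)
  then show "D' = D" by (metis vector_eq_ldot)
qed

lemma differentiable_imp_gderiv_gradient:
  fixes h :: "'a::euclidean_space \<Rightarrow> real"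
  assumes "h differentiable (at x)"
  shows "GDERIV h x :> gradient h x"
proof -
  obtain h' where h': "(h has_derivative h') (at x)" using assms unfolding differentiable_def by blast
  interpret h': bounded_linear h' using h' by (rule has_derivative_bounded_linear)
  have "h' v = v \<bullet> (\<Sum>b\<in>Basis. h' b *\<^sub>R b)" for v
  proof -
    have "h' v = h' (\<Sum>b\<in>Basis. (v \<bullet> b) *\<^sub>R b)" by (simp add: euclidean_representation)
    also have "\<dots> = (\<Sum>b\<in>Basis. (v \<bullet> b) * h' b)" by (simp add: h'.sum h'.scaleR)
    also have "\<dots> = v \<bullet> (\<Sum>b\<in>Basis. h' b *\<^sub>R b)" by (simp add: inner_sum_right mult.commute)
    finally show ?thesis .
  qed
  then have "h' = (\<lambda>v. v \<bullet> (\<Sum>b\<in>Basis. h' b *\<^sub>R b))" by (rule ext)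
  then have "GDERIV h x :> (\<Sum>b\<in>Basis. h' b *\<^sub>R b)" using h' unfolding gderiv_def by metis
  then show ?thesis using gradient_eqI by metis
qed

lemma twice_differentiable_imp_differentiable:
  assumes "twice_differentiable_at h a"
  shows "h differentiable (at a)"
  using assms eventually_nhds_x_imp_x unfolding twice_differentiable_at_def differentiable_def by blast

lemma jacobian_mult_eq_derivative:
  fixes h :: "real^'a \<Rightarrow> real^'b"
  assumes "(h has_derivative h') (at x)"
  shows "jacobian h (at x) *v v = h' v"
proof -
  have "h differentiable (at x)" using assms unfolding differentiable_def by blast
  then have "(h has_derivative (\<lambda>v. jacobian h (at x) *v v)) (at x)" using jacobian_works by blast
  then show ?thesis using has_derivative_unique[OF assms] by metis
qed

lemma gradient_lagrangian:
  assumes f: "(\<lambda>z. f \<nu> (z, w)) differentiable (at x)"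
    and F: "(\<lambda>z. player_F con F \<nu> (z, w)) differentiable (at x)"
  shows "gradient (\<lambda>z. lagrangian con f F w \<nu> z y) x = player_map con f F \<nu> (x, y, w)"
proof (rule gradient_eqI)
  let ?J = "jacobian (\<lambda>z. player_F con F \<nu> (z, w)) (at x)"
  have "((\<lambda>z. block con \<nu> y \<bullet> player_F con F \<nu> (z, w)) has_derivative (\<lambda>v. block con \<nu> y \<bullet> (?J *v v))) (at x)"
    using F[unfolded jacobian_works] by (intro has_derivative_inner_right)
  then have "GDERIV (\<lambda>z. block con \<nu> y \<bullet> player_F con F \<nu> (z, w)) x :> transpose ?J *v block con \<nu> y"
    unfolding gderiv_def by (simp add: dot_lmul_matrix inner_commute[of _ "_ v* _"])
  then show "GDERIV (\<lambda>z. lagrangian con f F w \<nu> z y) x :> player_map con f F \<nu> (x, y, w)"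
    unfolding lagrangian_def player_map_def prod.case
    by (intro GDERIV_add differentiable_imp_gderiv_gradient f)
qed

lemma bounded_linear_block: "bounded_linear (block con \<nu>)"
  by (intro linear_linear[THEN iffD2] linearI) (auto simp: block_def vec_eq_iff)

lemma block_0: "block con \<nu> 0 = 0"
  by (rule linear_0[OF bounded_linear.linear[OF bounded_linear_block]])

lemma bounded_bilinear_transpose_mult_block:
  "bounded_bilinear (\<lambda>(J :: real^'n^'m) y. transpose J *v block con \<nu> y)"
proof -
  note block = bounded_linear.linear[OF bounded_linear_block]
  have "bilinear (\<lambda>(J :: real^'n^'m) y. transpose J *v block con \<nu> y)"
    unfolding bilinear_def
    by (intro conjI allI linearI)
       (simp_all add: vec_eq_iff matrix_vector_mult_def transpose_def sum_distrib_left
         linear_add[OF block] linear_scale[OF block] algebra_simps sum.distrib del: transpose_matrix_vector)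
  then show ?thesis by (simp add: bilinear_conv_bounded_bilinear)
qed

section \<open>The game as a complementarity system\<close>

theorem theorem2p3:
  fixes own :: "'n::finite \<Rightarrow> 'p::finite"
    and con :: "'m::finite \<Rightarrow> 'p"
    and E :: "'m set"
    and f :: "'p \<Rightarrow> (real^'n) \<times> (real^'d::finite) \<Rightarrow> real"
    and F :: "(real^'n) \<times> (real^'d) \<Rightarrow> real^'m"
    and xbar :: "real^'n" and ybar :: "real^'m" and wbar :: "real^'d"
    and g :: "real^'n \<Rightarrow> real^'m"
    and Jg :: "'p \<Rightarrow> real^'n^'m"
    and G :: "real^'n^'n"
    and \<alpha> \<beta> :: "'p \<Rightarrow> 'm set"
  defines "g \<equiv> \<lambda>x. F (x, wbar)"
    and "Jg \<equiv> \<lambda>\<nu>. jacobian (\<lambda>x. player_F con F \<nu> (x, wbar)) (at xbar)"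
    and "G \<equiv> G_matrix own con f F wbar xbar ybar"
    and "\<alpha> \<equiv> \<alpha>_set con E g xbar ybar"
    and "\<beta> \<equiv> \<beta>_set con E g xbar ybar"
  assumes sol: "(xbar, ybar) \<in> S_Lag own con E f F (wbar, 0, 0)"
    and smooth: "\<And>\<nu>. \<exists>O'. open O' \<and> (xbar, wbar) \<in> O' \<and> (\<forall>(x, w) \<in> O'.
          twice_differentiable_at (\<lambda>z. f \<nu> (z, w)) x \<and>
          twice_differentiable_at (\<lambda>z. player_F con F \<nu> (z, w)) x \<and>
          strictly_differentiable_at (f \<nu>) (x, w) \<and>
          strictly_differentiable_at (player_F con F \<nu>) (x, w) \<and>
          strictly_differentiable_at (\<lambda>(x', w'). gradient (\<lambda>z. f \<nu> (z, w')) x') (x, w) \<and>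
          strictly_differentiable_at
            (\<lambda>(x', w'). jacobian (\<lambda>z. player_F con F \<nu> (z, w')) (at x')) (x, w))"
  shows "has_lipschitz_localization (S_Lag own con E f F) (wbar, 0, 0) (xbar, ybar) \<longleftrightarrow>
    (\<forall>\<beta>p \<beta>z \<beta>m \<alpha>p :: 'p \<Rightarrow> 'm set.
       (\<forall>\<nu>. \<beta> \<nu> = \<beta>p \<nu> \<union> \<beta>z \<nu> \<union> \<beta>m \<nu> \<and>
            \<beta>p \<nu> \<inter> \<beta>z \<nu> = {} \<and> \<beta>p \<nu> \<inter> \<beta>m \<nu> = {} \<and> \<beta>z \<nu> \<inter> \<beta>m \<nu> = {} \<and>
            \<alpha>p \<nu> = \<alpha> \<nu> \<union> \<beta>p \<nu>) \<longrightarrow>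
       (\<forall>(w1 :: real^'n) (w2 :: real^'m).
          transpose G *v w1 =
            (\<Sum>\<nu>\<in>UNIV. (\<Sum>i\<in>\<alpha>p \<nu>. w2 $ i *\<^sub>R row i (Jg \<nu>)) + (\<Sum>i\<in>\<beta>z \<nu>. w2 $ i *\<^sub>R row i (Jg \<nu>))) \<and>
          (\<forall>\<nu>. (\<forall>i\<in>\<alpha>p \<nu>. (Jg \<nu> *v block own \<nu> w1) $ i = 0) \<and>
               (\<forall>i\<in>\<beta>z \<nu>. (Jg \<nu> *v block own \<nu> w1) $ i \<le> 0) \<and>
               (\<forall>i\<in>\<beta>z \<nu>. 0 \<le> w2 $ i)) \<longrightarrow>
          w1 = 0 \<and> (\<forall>\<nu>. \<forall>i\<in>\<alpha>p \<nu> \<union> \<beta>z \<nu>. w2 $ i = 0)))"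
proof -
  have at_bar: "strictly_differentiable_at (player_F con F \<nu>) (xbar, wbar)"
    "strictly_differentiable_at (\<lambda>(x', w'). gradient (\<lambda>z. f \<nu> (z, w')) x') (xbar, wbar)"
    "strictly_differentiable_at (\<lambda>(x', w'). jacobian (\<lambda>z. player_F con F \<nu> (z, w')) (at x')) (xbar, wbar)" for \<nu>
    using smooth[of \<nu>] by blast+
  \<comment> \<open>\<open>G\<close> differentiates the Lagrangian gradient, so its formula is
    required on a whole neighborhood of \<open>xbar\<close> and not only there.\<close>
  have near: "\<forall>\<^sub>F x in nhds xbar. (\<lambda>z. f \<nu> (z, wbar)) differentiable (at x) \<and>
      (\<lambda>z. player_F con F \<nu> (z, wbar)) differentiable (at x)" for \<nu>
  proof -
    obtain O' where O': "open O'" "(xbar, wbar) \<in> O'" "\<forall>(x, w) \<in> O'.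
          twice_differentiable_at (\<lambda>z. f \<nu> (z, w)) x \<and>
          twice_differentiable_at (\<lambda>z. player_F con F \<nu> (z, w)) x"
      using smooth[of \<nu>] by fast
    have "((\<lambda>x. (x, wbar)) \<longlongrightarrow> (xbar, wbar)) (nhds xbar)"
      by (intro tendsto_Pair tendsto_const filterlim_ident)
    then have "\<forall>\<^sub>F x in nhds xbar. (x, wbar) \<in> O'" by (rule topological_tendstoD[OF _ O'(1,2)])
    then show ?thesis
    proof (rule eventually_mono)
      fix x assume "(x, wbar) \<in> O'"
      from bspec[OF O'(3) this] show "(\<lambda>z. f \<nu> (z, wbar)) differentiable (at x) \<and>
          (\<lambda>z. player_F con F \<nu> (z, wbar)) differentiable (at x)"
        by (simp add: twice_differentiable_imp_differentiable)
    qed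
  qed
  obtain DF where DF: "strict_derivative (player_F con F \<nu>) (DF \<nu>) (xbar, wbar)" for \<nu>
    using at_bar(1) unfolding strictly_differentiable_at_iff by metis
  obtain Df where Df: "strict_derivative (\<lambda>(x', w'). gradient (\<lambda>z. f \<nu> (z, w')) x') (Df \<nu>) (xbar, wbar)" for \<nu>
    using at_bar(2) unfolding strictly_differentiable_at_iff by metis
  obtain DJ where DJ: "strict_derivative (\<lambda>(x', w'). jacobian (\<lambda>z. player_F con F \<nu> (z, w')) (at x')) (DJ \<nu>) (xbar, wbar)" for \<nu>
    using at_bar(3) unfolding strictly_differentiable_at_iff by metis
  \<comment> \<open>\<open>B\<close> is the derivative of the stacked gradients in \<open>y\<close>.
    A multiplier enters only the Lagrangian of its owner, so column \<open>k\<close> is supported on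
    the variables of player \<open>con k\<close>; row \<open>k\<close> of \<open>C\<close> has no
    such restriction.\<close>
  define B :: "real^'m^'n" where "B = (\<chi> i k. if con k = own i then Jg (con k) $ k $ i else 0)"
  define C :: "real^'n^'m" where "C = (\<chi> k. Jg (con k) $ k)"
  \<comment> \<open>The derivative of the full Lagrangian gradient in \<open>(x, w)\<close> with the
    multiplier frozen at \<open>ybar\<close>.\<close>
  define Lx :: "'p \<Rightarrow> (real^'n) \<times> (real^'d) \<Rightarrow> real^'n"
    where "Lx = (\<lambda>\<nu> d. Df \<nu> d + transpose (DJ \<nu> d) *v block con \<nu> ybar)"
  define L where "L = (\<lambda>q. \<chi> i. player_map con f F (own i) q $ i)"
  have bl_proj: "bounded_linear (\<lambda>q :: (real^'n) \<times> (real^'m) \<times> (real^'d). (fst q, snd (snd q)))"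
    by (intro bounded_linear_Pair bounded_linear_fst bounded_linear_compose[OF bounded_linear_snd bounded_linear_snd])
  have bl_y: "bounded_linear (\<lambda>q :: (real^'n) \<times> (real^'m) \<times> (real^'d). fst (snd q))"
    by (rule bounded_linear_compose[OF bounded_linear_fst bounded_linear_snd])
  have player_deriv: "strict_derivative (player_map con f F \<nu>)
      (\<lambda>(dx, dy, dw). transpose (Jg \<nu>) *v block con \<nu> dy + Lx \<nu> (dx, dw)) (xbar, ybar, wbar)" for \<nu>
  proof -
    have "strict_derivative (\<lambda>q. (\<lambda>(x', w'). gradient (\<lambda>z. f \<nu> (z, w')) x') (fst q, snd (snd q)))
      (\<lambda>q. Df \<nu> (fst q, snd (snd q))) (xbar, ybar, wbar)"
      by (rule strict_derivative_compose_linear[OF bl_proj]) (simp add: Df)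
    moreover have "strict_derivative (\<lambda>q. (\<lambda>(x', w'). jacobian (\<lambda>z. player_F con F \<nu> (z, w')) (at x')) (fst q, snd (snd q)))
      (\<lambda>q. DJ \<nu> (fst q, snd (snd q))) (xbar, ybar, wbar)"
      by (rule strict_derivative_compose_linear[OF bl_proj]) (simp add: DJ)
    note strict_derivative_bilinear[OF bounded_bilinear_transpose_mult_block[of con \<nu>] this
        strict_derivative_linear[OF bl_y]]
    ultimately have "strict_derivative
      (\<lambda>q. (\<lambda>(x', w'). gradient (\<lambda>z. f \<nu> (z, w')) x') (fst q, snd (snd q)) +
        transpose ((\<lambda>(x', w'). jacobian (\<lambda>z. player_F con F \<nu> (z, w')) (at x')) (fst q, snd (snd q))) *v block con \<nu> (fst (snd q)))
      (\<lambda>q. Df \<nu> (fst q, snd (snd q)) + (transpose (Jg \<nu>) *v block con \<nu> (fst (snd q)) +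
         transpose (DJ \<nu> (fst q, snd (snd q))) *v block con \<nu> ybar)) (xbar, ybar, wbar)"
      using strict_derivative_add by (fastforce simp: Jg_def simp del: transpose_matrix_vector)
    then show ?thesis
      by (simp add: player_map_def Lx_def case_prod_unfold add_ac del: transpose_matrix_vector)
  qed
  have Lx_linear: "Lx \<nu> (dx, dw) = Lx \<nu> (dx, 0) + Lx \<nu> (0, dw)" for \<nu> dx dw
  proof -
    have "bounded_linear (\<lambda>q. (\<lambda>(dx, dy, dw). transpose (Jg \<nu>) *v block con \<nu> dy + Lx \<nu> (dx, dw)) (fst q, 0 :: real^'m, snd q))"
      by (intro bounded_linear_compose[OF strict_derivative_bounded_linear[OF player_deriv]]
          bounded_linear_Pair bounded_linear_fst bounded_linear_snd bounded_linear_zero)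
    then have "linear (Lx \<nu>)"
      by (simp add: block_0 bounded_linear.linear del: transpose_matrix_vector)
    from linear_add[OF this, of "(dx, 0)" "(0, dw)"] show ?thesis by simp
  qed
  \<comment> \<open>Differentiating the Lagrangian gradient of the owner of \<open>i\<close> at
    frozen \<open>ybar\<close> and \<open>wbar\<close> identifies row \<open>i\<close> of
    \<open>G\<close> with the \<open>x\<close> part of \<open>Lx\<close>.\<close>
  have G_mult: "(G *v dx) $ i = Lx (own i) (dx, 0) $ i" for dx i
  proof -
    let ?\<nu> = "own i"
    have lin: "strict_derivative (\<lambda>x. (x, ybar, wbar)) (\<lambda>dx. (dx, 0, 0)) xbar"
    proof -
      have "bounded_linear (\<lambda>dx :: real^'n. (dx, 0 :: real^'m, 0 :: real^'d))"
        by (intro bounded_linear_Pair bounded_linear_ident bounded_linear_zero)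
      then show ?thesis
        unfolding strict_derivative_def by (auto intro!: exI[of _ 1])
    qed
    have "((\<lambda>x. player_map con f F ?\<nu> (x, ybar, wbar)) has_derivative
        (\<lambda>dx. (\<lambda>(dx, dy, dw). transpose (Jg ?\<nu>) *v block con ?\<nu> dy + Lx ?\<nu> (dx, dw)) (dx, 0, 0))) (at xbar)"
      by (rule strict_derivative_imp_has_derivative[OF strict_derivative_compose[OF player_deriv lin]])
    then have deriv: "((\<lambda>x. player_map con f F ?\<nu> (x, ybar, wbar)) has_derivative (\<lambda>dx. Lx ?\<nu> (dx, 0))) (at xbar)"
      by (simp add: block_0 del: transpose_matrix_vector)
    have eq: "\<forall>\<^sub>F x in nhds xbar. player_map con f F ?\<nu> (x, ybar, wbar)
        = gradient (\<lambda>x'. lagrangian con f F wbar ?\<nu> x' ybar) x"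
      by (rule eventually_mono[OF near[of ?\<nu>]]) (simp add: gradient_lagrangian)
    have "((\<lambda>x. gradient (\<lambda>x'. lagrangian con f F wbar ?\<nu> x' ybar) x)
        has_derivative (\<lambda>dx. Lx ?\<nu> (dx, 0))) (at xbar)"
    proof (rule has_derivative_transform_eventually[OF deriv])
      show "\<forall>\<^sub>F x in at xbar. player_map con f F ?\<nu> (x, ybar, wbar)
          = gradient (\<lambda>x'. lagrangian con f F wbar ?\<nu> x' ybar) x"
        unfolding eventually_at_filter by (rule eventually_mono[OF eq]) simp
    qed (use eventually_nhds_x_imp_x[OF eq] in simp_all)
    from jacobian_mult_eq_derivative[OF this, of dx]
    show ?thesis by (simp add: G_def G_matrix_def matrix_vector_mult_def vec_eq_iff)
  qed
  have B_mult: "(B *v dy) $ i = (transpose (Jg (own i)) *v block con (own i) dy) $ i" for dy i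
    by (auto simp: B_def matrix_vector_mult_def transpose_def block_def intro!: sum.cong)
  have C_mult: "(C *v dx) $ k = DF (con k) (dx, 0) $ k" for dx k
  proof -
    have "strict_derivative (\<lambda>x. (x, wbar)) (\<lambda>dx. (dx, 0)) xbar"
    proof -
      have "bounded_linear (\<lambda>dx :: real^'n. (dx, 0 :: real^'d))"
        by (intro bounded_linear_Pair bounded_linear_ident bounded_linear_zero)
      then show ?thesis unfolding strict_derivative_def by (auto intro!: exI[of _ 1])
    qed
    from jacobian_mult_eq_derivative[OF strict_derivative_imp_has_derivative[OF
          strict_derivative_compose[OF DF this]], of "con k" dx]
    show ?thesis by (simp add: C_def Jg_def matrix_vector_mult_def vec_eq_iff)
  qed
  have L_deriv: "strict_derivative L
      (\<lambda>(dx, dy, dw). G *v dx + B *v dy + (\<chi> i. Lx (own i) (0, dw) $ i)) (xbar, ybar, wbar)"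
  proof (rule strict_derivative_componentwise)
    fix i
    have "(\<lambda>q. ((\<lambda>(dx, dy, dw). G *v dx + B *v dy + (\<chi> i. Lx (own i) (0, dw) $ i)) q) $ i) =
      (\<lambda>q. (\<lambda>(dx, dy, dw). transpose (Jg (own i)) *v block con (own i) dy + Lx (own i) (dx, dw)) q $ i)"
    proof
      fix q :: "(real^'n) \<times> (real^'m) \<times> (real^'d)"
      obtain dx dy dw where q: "q = (dx, dy, dw)" by (rule prod_cases3)
      show "((\<lambda>(dx, dy, dw). G *v dx + B *v dy + (\<chi> i. Lx (own i) (0, dw) $ i)) q) $ i =
        (\<lambda>(dx, dy, dw). transpose (Jg (own i)) *v block con (own i) dy + Lx (own i) (dx, dw)) q $ i"
        by (simp add: q G_mult B_mult Lx_linear[of "own i" dx dw] del: transpose_matrix_vector)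
    qed
    then show "strict_derivative (\<lambda>q. L q $ i)
        (\<lambda>q. ((\<lambda>(dx, dy, dw). G *v dx + B *v dy + (\<chi> i. Lx (own i) (0, dw) $ i)) q) $ i) (xbar, ybar, wbar)"
      using strict_derivative_linear_compose[OF bounded_linear_vec_nth player_deriv] by (simp add: L_def)
  qed
  have F_deriv: "strict_derivative F
      (\<lambda>(dx, dw). C *v dx + (\<chi> k. DF (con k) (0, dw) $ k)) (xbar, wbar)"
  proof (rule strict_derivative_componentwise)
    fix k
    have "(\<lambda>q. ((\<lambda>(dx, dw). C *v dx + (\<chi> k. DF (con k) (0, dw) $ k)) q) $ k) = (\<lambda>q. DF (con k) q $ k)"
    proof
      fix q :: "(real^'n) \<times> (real^'d)"
      obtain dx dw where q: "q = (dx, dw)" by (rule prod.exhaust)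
      have "DF (con k) q = DF (con k) (dx, 0) + DF (con k) (0, dw)"
        using linear_add[OF bounded_linear.linear[OF strict_derivative_bounded_linear[OF DF]],
            of "con k" "(dx, 0)" "(0, dw)"] by (simp add: q)
      then show "((\<lambda>(dx, dw). C *v dx + (\<chi> k. DF (con k) (0, dw) $ k)) q) $ k = DF (con k) q $ k"
        by (simp add: q C_mult)
    qed
    moreover have "(\<lambda>q. F q $ k) = (\<lambda>q. player_F con F (con k) q $ k)"
      by (simp add: player_F_def block_def)
    ultimately show "strict_derivative (\<lambda>q. F q $ k)
        (\<lambda>q. ((\<lambda>(dx, dw). C *v dx + (\<chi> k. DF (con k) (0, dw) $ k)) q) $ k) (xbar, wbar)"
      using strict_derivative_linear_compose[OF bounded_linear_vec_nth DF] by simp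
  qed
  have "L (xbar, ybar, wbar) = 0" "complementary E ybar (F (xbar, wbar))"
    using sol unfolding S_Lag_iff L_def by simp_all
  with L_deriv F_deriv interpret complementarity_system L F E xbar ybar wbar G B C
      "\<lambda>dw. \<chi> i. Lx (own i) (0, dw) $ i" "\<lambda>dw. \<chi> k. DF (con k) (0, dw) $ k"
    by unfold_locales
  have "(x, y) \<in> S_Lag own con E f F (w, v, u) \<longleftrightarrow> L (x, y, w) = v \<and> complementary E y (F (x, w) - u)"
    for x y w v u
    by (simp only: S_Lag_iff L_def)
  then have "S_Lag own con E f F p = solutions p" for p
    by (cases p) (auto simp: solutions_def)
  then have S: "S_Lag own con E f F = solutions" by (rule ext)
  have "has_lipschitz_localization (S_Lag own con E f F) (wbar, 0, 0) (xbar, ybar) \<longleftrightarrow>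
      critical_condition strongly_active weakly_active G B C"
    unfolding S using solutions_localization localization_imp_critical by blast
  also have "\<dots> \<longleftrightarrow> (\<forall>\<beta>p \<beta>z \<beta>m \<alpha>p :: 'p \<Rightarrow> 'm set.
       (\<forall>\<nu>. \<beta> \<nu> = \<beta>p \<nu> \<union> \<beta>z \<nu> \<union> \<beta>m \<nu> \<and>
            \<beta>p \<nu> \<inter> \<beta>z \<nu> = {} \<and> \<beta>p \<nu> \<inter> \<beta>m \<nu> = {} \<and> \<beta>z \<nu> \<inter> \<beta>m \<nu> = {} \<and>
            \<alpha>p \<nu> = \<alpha> \<nu> \<union> \<beta>p \<nu>) \<longrightarrow>
       (\<forall>(w1 :: real^'n) (w2 :: real^'m).
          transpose G *v w1 =
            (\<Sum>\<nu>\<in>UNIV. (\<Sum>i\<in>\<alpha>p \<nu>. w2 $ i *\<^sub>R row i (Jg \<nu>)) + (\<Sum>i\<in>\<beta>z \<nu>. w2 $ i *\<^sub>R row i (Jg \<nu>))) \<and>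
          (\<forall>\<nu>. (\<forall>i\<in>\<alpha>p \<nu>. (Jg \<nu> *v block own \<nu> w1) $ i = 0) \<and>
               (\<forall>i\<in>\<beta>z \<nu>. (Jg \<nu> *v block own \<nu> w1) $ i \<le> 0) \<and>
               (\<forall>i\<in>\<beta>z \<nu>. 0 \<le> w2 $ i)) \<longrightarrow>
          w1 = 0 \<and> (\<forall>\<nu>. \<forall>i\<in>\<alpha>p \<nu> \<union> \<beta>z \<nu>. w2 $ i = 0)))"
  proof (rule critical_condition_iff_blocks)
    show "row k C = row k (Jg (con k))" for k by (simp add: row_def C_def)
    show "column k B \<bullet> w = (Jg (con k) *v block own (con k) w) $ k" for k w
      by (auto simp: column_def B_def inner_vec_def matrix_vector_mult_def block_def intro!: sum.cong)
    show "\<alpha> \<nu> = {k \<in> strongly_active. con k = \<nu>}" for \<nu>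
      by (auto simp: \<alpha>_def \<alpha>_set_def g_def strongly_active_def)
    show "\<beta> \<nu> = {k \<in> weakly_active. con k = \<nu>}" for \<nu>
      by (auto simp: \<beta>_def \<beta>_set_def g_def weakly_active_def)
    show "strongly_active \<inter> weakly_active = {}" by (rule active_disjoint)
  qed
  finally show ?thesis .
qed

end
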